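(* Let $g\ge 0$, $m>0$, $d>0$ be integers, let $\beta=(\beta_1,\ldots,\beta_n)=[1^{a_1},2^{a_2},\ldots,d^{a_d}]\vdash d$, and let $t=2g+n-1+m-d$ (assumed $\ge 0$). Put $c_1=a_1-1$ and $c_i=a_i$ for $1<i\le d$. Then $$\mathsf{H}^g_{d,m}(\beta)=t!\,d^{t-1}\,[y^{2g+m-d}]\left.\left\{\frac{\partial^d}{\partial x^d}\,x^{\frac{d-1}{2}}\cdot\frac{(\log x)^m}{m!}\cdot\prod_{i=1}^d\left(\frac{\sinh(\frac{i}{2}\log x+\frac{i}{2}y)}{iy/2}\right)^{c_i}\right\}\right|_{x=1}.$$
   Context: For a partition $\beta\vdash d$ written as $[1^{a_1},\ldots,d^{a_d}]$ ($a_i$ parts equal to $i$), with $n=\ell(\beta)$ parts, let $\mathrm{Aut}(\beta)=\prod_i a_i!$. For integers $g\ge 0$, $m>0$ with $t=2g-1+n+m-d\ge 0$, the one-part quasi-triple Hurwitz number is $$\mathsf{H}^g_{d,m}(\beta)=\frac{\mathrm{Aut}(\beta)}{d!}\,N,$$ where $N$ is the number of tuples $(\sigma_0,\tau_1,\ldots,\tau_t,\sigma_{t+1})$ in $\mathfrak{S}_d$ with $\sigma_0$ a $d$-cycle, each $\tau_i$ a transposition, $\sigma_{t+1}$ of cycle type $\beta$, and $\sigma_0\tau_1\cdots\tau_t\sigma_{t+1}$ having exactly $m$ cycles. $[y^k]F$ denotes the coefficient of $y^k$ in $F$; the expression in braces is regarded as a Laurent series in $y$ whose coefficients are functions of $x$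 analytic near $x=1$, and $\sinh u=(e^u-e^{-u})/2$. *)

theory Defs
  imports "HOL-Complex_Analysis.Complex_Analysis" "HOL-Combinatorics.Combinatorics"
    "HOL-Library.Multiset"
begin

definition cycles_of :: "nat \<Rightarrow> (nat \<Rightarrow> nat) \<Rightarrow> nat set set" where
  "cycles_of d p = (\<lambda>x. orbit p x) ` {0..<d}"

definition cycle_type :: "nat \<Rightarrow> (nat \<Rightarrow> nat) \<Rightarrow> nat multiset" where
  "cycle_type d p = image_mset card (mset_set (cycles_of d p))"

definition num_cycles :: "nat \<Rightarrow> (nat \<Rightarrow> nat) \<Rightarrow> nat" where
  "num_cycles d p = card (cycles_of d p)"

definition is_transposition :: "nat \<Rightarrow> (nat \<Rightarrow> nat) \<Rightarrow> bool" where
  "is_transposition d p \<longleftrightarrow> (\<exists>a b. a < d \<and> b < d \<and> a \<noteq> b \<and> p = Transposition.transpose a b)"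

definition is_partition :: "nat multiset \<Rightarrow> nat \<Rightarrow> bool" where
  "is_partition \<beta> d \<longleftrightarrow> 0 \<notin># \<beta> \<and> sum_mset \<beta> = d"

definition Aut :: "nat multiset \<Rightarrow> nat" where
  "Aut \<beta> = (\<Prod>i\<in>set_mset \<beta>. fact (count \<beta> i))"

definition hurwitz_tuples :: "nat \<Rightarrow> nat \<Rightarrow> nat \<Rightarrow> nat multiset
    \<Rightarrow> ((nat \<Rightarrow> nat) \<times> (nat \<Rightarrow> nat) list \<times> (nat \<Rightarrow> nat)) set" where
  "hurwitz_tuples d m t \<beta> =
     {(\<sigma>0, ts, \<sigma>1). \<sigma>0 permutes {0..<d} \<and> cycle_type d \<sigma>0 = {#d#} \<and>
        length ts = t \<and> (\<forall>\<tau>\<in>set ts. is_transposition d \<tau>) \<and>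
        \<sigma>1 permutes {0..<d} \<and> cycle_type d \<sigma>1 = \<beta> \<and>
        num_cycles d (\<sigma>0 \<circ> foldr (\<circ>) ts id \<circ> \<sigma>1) = m}"

definition hurwitz_t :: "nat \<Rightarrow> nat \<Rightarrow> nat \<Rightarrow> nat multiset \<Rightarrow> int" where
  "hurwitz_t g d m \<beta> = 2 * int g - 1 + int (size \<beta>) + int m - int d"

definition quasi_triple_H :: "nat \<Rightarrow> nat \<Rightarrow> nat \<Rightarrow> nat multiset \<Rightarrow> complex" where
  "quasi_triple_H g d m \<beta> =
     of_nat (Aut \<beta>) / of_nat (fact d) *
     of_nat (card (hurwitz_tuples d m (nat (hurwitz_t g d m \<beta>)) \<beta>))"

text \<open>Exponents c_i (c_1 = a_1 - 1 may be -1).\<close>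
definition cexp :: "nat multiset \<Rightarrow> nat \<Rightarrow> int" where
  "cexp \<beta> i = (if i = 1 then int (count \<beta> 1) - 1 else int (count \<beta> i))"

definition generating_fn :: "nat \<Rightarrow> nat \<Rightarrow> nat multiset \<Rightarrow> complex \<Rightarrow> complex \<Rightarrow> complex" where
  "generating_fn d m \<beta> x y =
     x powr ((of_nat d - 1) / 2) * (Ln x) ^ m / of_nat (fact m) *
     (\<Prod>i=1..d. (sinh (of_nat i / 2 * Ln x + of_nat i / 2 * y) / (of_nat i * y / 2))
                   powi cexp \<beta> i)"

text \<open>Coefficient of y^k of the Laurent expansion in y valid on the annulus
  containing the unit circle (for x near 1); via Cauchy's formula.\<close>
definition laurent_coeff_y :: "(complex \<Rightarrow> complex \<Rightarrow> complex) \<Rightarrow> int \<Rightarrow> complex \<Rightarrow> complex" where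
  "laurent_coeff_y F k x =
     contour_integral (circlepath 0 1) (\<lambda>y. F x y * y powi (- (k + 1))) / (2 * of_real pi * \<i>)"

end

theory Submission
  imports Defs
begin

text \<open>
  For a permutation with cycle lengths \<open>\<beta>\<close> of a set with \<open>d\<close> elements put
  \<open>Q = (\<Prod>k\<in>#\<beta>. 1 - X ^ k) / (1 - X)\<close>; up to sign its coefficients are the values of the hook
  characters at \<open>\<beta>\<close>, but no representation theory is needed. Multiplying a permutation by all
  transpositions moving a fixed point \<open>b\<close> cuts the cycle of \<open>b\<close> or joins it to another one, and
  the resulting sum of the products \<open>\<Prod>(1 - X ^ k)\<close> has a closed form. Summed over \<open>b\<close>, this shows that
  summing over all transpositions multiplies the \<open>l\<close>-th coefficient of \<open>Q\<close> by
  \<open>d * ((d - 1) / 2 - l)\<close>. Used once per inserted point, it determines by induction on the set the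
  generating function of the numbers of cycles of \<open>\<sigma> \<circ> p\<close>, with \<open>\<sigma>\<close> ranging over the
  \<open>d\<close>-cycles. Both facts together count the tuples with a fixed last entry. On the analytic side, with
  \<open>u = Ln x + y\<close>, the product of hyperbolic sines is a monomial factor times \<open>Q (exp (- u))\<close>, so the
  Laurent coefficient is a sum of terms \<open>x ^ k * Ln x ^ m\<close>, whose \<open>d\<close>-th derivatives at 1 are the
  coefficients of falling factorials.
\<close>

section \<open>Cycle types and transpositions\<close>

text \<open>The set is an argument of its own, not the support of the permutation: fixed points in
  \<open>S\<close> count as cycles of length 1, and \<open>S\<close> may be any union of cycles, for
  instance what is left after one cycle is removed.\<close>

definition cyc_type :: "'a set \<Rightarrow> ('a \<Rightarrow> 'a) \<Rightarrow> nat multiset" where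
  "cyc_type S p = image_mset card (mset_set (orbit p ` S))"

text \<open>Following \<open>q\<close> along an explicit list of points that closes up gives its
  orbit. The cycles of a permutation multiplied by a transposition are read off in this way.\<close>

lemma orbit_eq_imageI:
  assumes "n > 0" and step: "\<And>j. Suc j < n \<Longrightarrow> q (f j) = f (Suc j)" and last: "q (f (n - 1)) = f 0"
  shows "orbit q (f 0) = f ` {..<n}"
proof -
  have pow: "(q ^^ j) (f 0) = f j" if "j < n" for j
    using that by (induction j) (auto simp: step)
  have "(q ^^ n) (f 0) = q ((q ^^ (n - 1)) (f 0))"
    using \<open>n > 0\<close> by (cases n) auto
  also have "\<dots> = f 0"
    using pow[of "n - 1"] \<open>n > 0\<close> last by simp
  finally have "orbit q (f 0) = {(q ^^ j) (f 0) |j. j < n}"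
    using \<open>n > 0\<close> by (rule orbit_altdef_bounded)
  also have "\<dots> = f ` {..<n}"
    using pow by auto metis
  finally show ?thesis .
qed

lemma orbit_eq_of_mem:
  assumes "permutation p" "c \<in> orbit p b"
  shows "orbit p c = orbit p b"
  using cyclic_on_orbit'[OF assms(1)] assms(2) by (rule orbit_cyclic_eq3)

lemma orbit_disjoint:
  assumes "permutation p" "a \<notin> orbit p b"
  shows "orbit p b \<inter> orbit p a = {}"
proof (rule ccontr)
  assume "orbit p b \<inter> orbit p a \<noteq> {}"
  then obtain x where "x \<in> orbit p b" "x \<in> orbit p a" by blast
  then have "orbit p a = orbit p b"
    using orbit_eq_of_mem[OF assms(1)] by metis
  then show False using permutation_self_in_orbit[OF assms(1), of a] assms(2) by simp
qed

lemma finite_orbit_permutation: "permutation p \<Longrightarrow> finite (orbit p b)"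
  by (intro finite_orbit permutation_self_in_orbit)

lemma card_orbit_pos: "permutation p \<Longrightarrow> card (orbit p b) > 0"
  by (simp add: card_gt_0_iff finite_orbit_permutation orbit_nonempty)

text \<open>The orbit length is the least positive return time of \<open>b\<close>, which is
  \<open>funpow_dist1\<close>; so the powers below it enumerate the orbit without
  repetition.\<close>

lemma orbit_period:
  fixes b :: 'a
  assumes "permutation p"
  defines "L \<equiv> card (orbit p b)"
  shows "(p ^^ L) b = b" and "orbit p b = (\<lambda>j. (p ^^ j) b) ` {..<L}"
    and "inj_on (\<lambda>j. (p ^^ j) b) {..<L}"
proof -
  have self: "b \<in> orbit p b"
    using assms by (intro permutation_self_in_orbit)
  have L: "L = funpow_dist1 p b b"
    using card_image[OF inj_on_funpow_dist1[OF self]] orbit_conv_funpow_dist1[OF self]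
    by (simp add: L_def)
  show "(p ^^ L) b = b"
    unfolding L using funpow_dist1_prop[OF self] .
  show "orbit p b = (\<lambda>j. (p ^^ j) b) ` {..<L}"
    unfolding L using orbit_conv_funpow_dist1[OF self] by (simp only: atLeast0LessThan)
  show "inj_on (\<lambda>j. (p ^^ j) b) {..<L}"
    unfolding L using inj_on_funpow_dist1[OF self] by (simp only: atLeast0LessThan)
qed

text \<open>An orbit that starts in the closed set \<open>C\<close> stays there, and one that starts
  in \<open>S - C\<close> contains its starting point, so no cycle is counted on both sides.\<close>

lemma cyc_type_split:
  assumes "finite S" "permutation p" "\<And>c. c \<in> C \<Longrightarrow> p c \<in> C"
  shows "cyc_type S p = cyc_type (S \<inter> C) p + cyc_type (S - C) p"
proof -
  have "orbit p c \<subseteq> C" if "c \<in> C" for c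
  proof
    fix x assume "x \<in> orbit p c"
    then show "x \<in> C" by induct (auto intro: assms that)
  qed
  then have "orbit p ` (S \<inter> C) \<inter> orbit p ` (S - C) = {}"
    using permutation_self_in_orbit[OF assms(2)] by fastforce
  moreover have "orbit p ` S = orbit p ` (S \<inter> C) \<union> orbit p ` (S - C)"
    by auto
  ultimately show ?thesis
    using assms(1) by (simp add: cyc_type_def mset_set_Union)
qed

lemma cyc_type_orbit:
  assumes "permutation p"
  shows "cyc_type (orbit p b) p = {#card (orbit p b)#}"
proof -
  have "orbit p ` orbit p b = {orbit p b}"
    using orbit_eq_of_mem[OF assms] orbit_nonempty by fastforce
  then show ?thesis by (simp add: cyc_type_def)
qed

lemma cyc_type_orbit_split:
  assumes "finite S" "permutation p" "orbit p b \<subseteq> S"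
  shows "cyc_type S p = add_mset (card (orbit p b)) (cyc_type (S - orbit p b) p)"
proof -
  have "cyc_type S p = cyc_type (S \<inter> orbit p b) p + cyc_type (S - orbit p b) p"
    using assms by (intro cyc_type_split) (auto intro: orbit.step)
  moreover have "S \<inter> orbit p b = orbit p b"
    using assms by auto
  ultimately show ?thesis using cyc_type_orbit[OF assms(2)] by simp
qed

lemma cyc_type_cong:
  assumes "\<And>c. c \<in> S \<Longrightarrow> orbit q c = orbit p c"
  shows "cyc_type S q = cyc_type S p"
  using assms by (simp add: cyc_type_def cong: image_cong)

section \<open>Cutting and joining cycles by a transposition\<close>

lemma orbit_transpose_comp_other:
  assumes "permutation p" "a \<notin> orbit p c" "b \<notin> orbit p c"
  shows "orbit (Transposition.transpose a b \<circ> p) c = orbit p c"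
proof (rule orbit_cong)
  show "c \<in> orbit p c" using assms by (intro permutation_self_in_orbit)
  fix s assume "s \<in> orbit p c"
  then have "p s \<in> orbit p c" by (rule orbit.step)
  then have "p s \<noteq> a" "p s \<noteq> b" using assms by auto
  then show "(Transposition.transpose a b \<circ> p) s = p s" by simp
qed

lemma permutes_transpose_comp:
  assumes "p permutes S" "a \<in> S" "b \<in> S"
  shows "Transposition.transpose a b \<circ> p permutes S"
  using assms by (intro permutes_compose permutes_swap_id)

text \<open>The transposition acts after \<open>p\<close>, so it only redirects the two arrows that
  enter \<open>b\<close> and \<open>(p ^^ i) b\<close>. The walk from \<open>b\<close> now closes
  after \<open>i\<close> steps, the walk from \<open>(p ^^ i) b\<close> after the remaining ones,
  and all other cycles are untouched. The old length is added on the left to avoid a multiset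
  difference.\<close>

lemma cyc_type_cut:
  assumes "finite S" "p permutes S" "b \<in> S"
    and "0 < i" "i < card (orbit p b)"
  shows "add_mset (card (orbit p b)) (cyc_type S (Transposition.transpose ((p ^^ i) b) b \<circ> p)) =
         cyc_type S p + {#i, card (orbit p b) - i#}"
proof -
  define L where "L = card (orbit p b)"
  define g where "g = (\<lambda>j. (p ^^ j) b)"
  define q where "q = Transposition.transpose (g i) b \<circ> p"
  note P = permutes_imp_permutation[OF assms(1,2)]
  have g0: "g 0 = b" and gL: "g L = b" and gs: "p (g j) = g (Suc j)" for j
    using orbit_period(1)[OF P, of b] by (auto simp: g_def L_def)
  have orb: "orbit p b = g ` {..<L}" and inj: "inj_on g {..<L}"
    using orbit_period(2,3)[OF P, of b] by (simp_all add: g_def L_def)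
  have iL: "0 < i" "i < L" using assms by (auto simp: L_def)
  have ne: "g j \<noteq> g k" if "j < L" "k < L" "j \<noteq> k" for j k
    using inj that by (auto dest: inj_onD)
  have sub: "orbit p b \<subseteq> S"
    using assms by (intro permutes_orbit_subset)
  have giS: "g i \<in> S" using sub iL orb by auto
  have q: "q permutes S"
    unfolding q_def using assms giS by (intro permutes_transpose_comp)
  note Q = permutes_imp_permutation[OF assms(1) q]
  have o1: "orbit q b = g ` {..<i}"
  proof -
    have "orbit q (g 0) = g ` {..<i}"
    proof (rule orbit_eq_imageI)
      show "q (g j) = g (Suc j)" if "Suc j < i" for j
        using that iL ne[of "Suc j" 0] ne[of "Suc j" i] by (simp add: q_def gs g0)
      show "q (g (i - 1)) = g 0"
        using iL by (simp add: q_def gs g0)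
    qed (use iL in auto)
    then show ?thesis by (simp add: g0)
  qed
  have o2: "orbit q (g i) = g ` {i..<L}"
  proof -
    \<comment> \<open>The rest of the cycle, enumerated from its own starting point. Its last step
      would lead to \<open>g L = b\<close>, which the transposition sends back to
      \<open>g i\<close>.\<close>
    have "orbit q (g (i + 0)) = (\<lambda>j. g (i + j)) ` {..<L - i}"
    proof (rule orbit_eq_imageI)
      show "q (g (i + j)) = g (i + Suc j)" if "Suc j < L - i" for j
        using that iL ne[of "Suc (i + j)" 0] ne[of "Suc (i + j)" i] by (simp add: q_def gs g0)
      show "q (g (i + (L - i - 1))) = g (i + 0)"
        using iL by (simp add: q_def gs gL)
    qed (use iL in auto)
    also have "(\<lambda>j. g (i + j)) ` {..<L - i} = g ` ((+) i ` {..<L - i})"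
      by (simp add: image_image)
    also have "(+) i ` {..<L - i} = {i..<L}"
      using iL by (simp add: lessThan_atLeast0)
    finally show ?thesis by simp
  qed
  have c1: "card (orbit q b) = i"
    unfolding o1 using inj iL by (subst card_image) (auto intro: inj_on_subset)
  have c2: "card (orbit q (g i)) = L - i"
    unfolding o2 using inj iL by (subst card_image) (auto intro: inj_on_subset)
  have un: "orbit p b = orbit q b \<union> orbit q (g i)"
    unfolding o1 o2 orb image_Un[symmetric] using iL by (intro arg_cong[of _ _ "(`) g"]) auto
  have disj: "orbit q b \<inter> orbit q (g i) = {}"
    unfolding o1 o2 using ne iL by auto
  have "cyc_type S q = add_mset i (cyc_type (S - orbit q b) q)"
    using cyc_type_orbit_split[OF assms(1) Q, of b] sub un c1 by auto
  also have "cyc_type (S - orbit q b) q =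
      add_mset (L - i) (cyc_type (S - orbit q b - orbit q (g i)) q)"
    using cyc_type_orbit_split[OF _ Q, of "S - orbit q b" "g i"] sub un disj c2 assms(1) by auto
  also have "S - orbit q b - orbit q (g i) = S - orbit p b"
    using un by auto
  also have "cyc_type (S - orbit p b) q = cyc_type (S - orbit p b) p"
  proof (rule cyc_type_cong)
    fix c assume c: "c \<in> S - orbit p b"
    have "x \<notin> orbit p c" if "x \<in> orbit p b" for x
      using orbit_disjoint[OF P, of c b] that c by blast
    then show "orbit q c = orbit p c"
      unfolding q_def using orb iL g0
      by (intro orbit_transpose_comp_other P) auto
  qed
  finally have "add_mset L (cyc_type S q) = {#i, L - i#} + add_mset L (cyc_type (S - orbit p b) p)"
    by simp
  also have "add_mset L (cyc_type (S - orbit p b) p) = cyc_type S p"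
    using cyc_type_orbit_split[OF assms(1) P sub] by (simp add: L_def)
  finally show ?thesis by (simp add: q_def g_def L_def comp_def)
qed

text \<open>The arrow that closed the cycle of \<open>b\<close> now leads to \<open>a\<close>, and
  the one that closed the cycle of \<open>a\<close> leads to \<open>b\<close>, so the two cycles
  become one.\<close>

lemma cyc_type_join:
  assumes "finite S" "p permutes S" "b \<in> S" "a \<in> S" "a \<notin> orbit p b"
  shows "cyc_type S (Transposition.transpose a b \<circ> p) + {#card (orbit p b), card (orbit p a)#} =
         add_mset (card (orbit p b) + card (orbit p a)) (cyc_type S p)"
proof -
  define L M where "L = card (orbit p b)" and "M = card (orbit p a)"
  define g h where "g = (\<lambda>j. (p ^^ j) b)" and "h = (\<lambda>j. (p ^^ j) a)"
  define q where "q = Transposition.transpose a b \<circ> p"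
  note P = permutes_imp_permutation[OF assms(1,2)]
  have q: "q permutes S"
    unfolding q_def using assms by (intro permutes_transpose_comp)
  note Q = permutes_imp_permutation[OF assms(1) q]
  have g0: "g 0 = b" and gL: "g L = b" and gs: "p (g j) = g (Suc j)" for j
    using orbit_period(1)[OF P, of b] by (auto simp: g_def L_def)
  have h0: "h 0 = a" and hM: "h M = a" and hs: "p (h j) = h (Suc j)" for j
    using orbit_period(1)[OF P, of a] by (auto simp: h_def M_def)
  have orbg: "orbit p b = g ` {..<L}" and injg: "inj_on g {..<L}"
    using orbit_period(2,3)[OF P, of b] by (simp_all add: g_def L_def)
  have orbh: "orbit p a = h ` {..<M}" and injh: "inj_on h {..<M}"
    using orbit_period(2,3)[OF P, of a] by (simp_all add: h_def M_def)
  have pos: "0 < L" "0 < M" using card_orbit_pos[OF P] by (auto simp: L_def M_def)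
  have disj: "orbit p b \<inter> orbit p a = {}"
    using P assms(5) by (rule orbit_disjoint)
  have gne: "g j \<noteq> b" "g j \<noteq> a" if "0 < j" "j < L" for j
    using inj_onD[OF injg, of j 0] that g0 assms(5) orbg by auto
  have hne: "h j \<noteq> a" "h j \<noteq> b" if "0 < j" "j < M" for j
    using inj_onD[OF injh, of j 0] that h0 disj permutation_self_in_orbit[OF P, of b] orbh by auto
  have sub: "orbit p b \<subseteq> S" "orbit p a \<subseteq> S"
    using assms by (blast dest: permutes_orbit_subset)+
  \<comment> \<open>The joined cycle: first the old cycle of \<open>b\<close>, then that of
    \<open>a\<close>.\<close>
  define f where "f = (\<lambda>j. if j < L then g j else h (j - L))"
  have o: "orbit q b = orbit p b \<union> orbit p a"
  proof -
    have "orbit q (f 0) = f ` {..<L + M}"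
    proof (rule orbit_eq_imageI)
      fix j assume j: "Suc j < L + M"
      consider "Suc j < L" | "Suc j = L" | "L \<le> j" by linarith
      then show "q (f j) = f (Suc j)"
      proof cases
        case 1
        then show ?thesis using gne[of "Suc j"] by (simp add: f_def q_def gs)
      next
        case 2
        then show ?thesis using gL h0 by (auto simp: f_def q_def gs)
      next
        case 3
        then show ?thesis using hne[of "Suc (j - L)"] j
          by (simp add: f_def q_def hs Suc_diff_le)
      qed
    next
      have "\<not> L + M - 1 < L" "L + M - 1 - L = M - 1" using pos by auto
      then have "f (L + M - 1) = h (M - 1)" by (simp only: f_def if_False)
      then show "q (f (L + M - 1)) = f 0"
        using pos by (simp add: f_def q_def hs hM g0)
    qed (use pos in auto)
    also have "f 0 = b" using pos by (simp add: f_def g0)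
    also have "{..<L + M} = {..<L} \<union> (+) L ` {..<M}"
      by (auto simp: lessThan_atLeast0)
    also have "f ` \<dots> = g ` {..<L} \<union> h ` {..<M}"
      unfolding image_Un image_image by (intro arg_cong2[of _ _ _ _ "(\<union>)"] image_cong) (auto simp: f_def)
    finally show ?thesis by (simp add: orbg orbh)
  qed
  have c: "card (orbit q b) = L + M"
    unfolding o L_def M_def using disj by (intro card_Un_disjoint finite_orbit_permutation P)
  have "cyc_type S q = add_mset (L + M) (cyc_type (S - orbit q b) q)"
    using cyc_type_orbit_split[OF assms(1) Q, of b] sub o c by auto
  also have "cyc_type (S - orbit q b) q = cyc_type (S - orbit q b) p"
  proof (rule cyc_type_cong)
    fix c assume c: "c \<in> S - orbit q b"
    have "x \<notin> orbit p c" if "x \<in> orbit p b \<union> orbit p a" for x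
      using orbit_disjoint[OF P, of c b] orbit_disjoint[OF P, of c a] that c o by blast
    then show "orbit q c = orbit p c"
      unfolding q_def using permutation_self_in_orbit[OF P]
      by (intro orbit_transpose_comp_other P) auto
  qed
  also have "S - orbit q b = S - orbit p b - orbit p a"
    using o by auto
  finally have "cyc_type S q + {#L, M#} =
      add_mset (L + M) (add_mset L (add_mset M (cyc_type (S - orbit p b - orbit p a) p)))"
    by simp
  also have "add_mset M (cyc_type (S - orbit p b - orbit p a) p) = cyc_type (S - orbit p b) p"
  proof -
    have "orbit p a \<subseteq> S - orbit p b" using sub disj by blast
    then show ?thesis
      using cyc_type_orbit_split[OF _ P, of "S - orbit p b" a] assms(1) by (simp add: M_def)
  qed
  also have "add_mset L (cyc_type (S - orbit p b) p) = cyc_type S p"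
    using cyc_type_orbit_split[OF assms(1) P sub(1)] by (simp add: L_def)
  finally show ?thesis by (simp add: q_def L_def M_def comp_def)
qed

lemma cyc_type_fixpoint:
  assumes "finite S" "x \<notin> S" "p permutes S"
  shows "cyc_type (insert x S) p = add_mset 1 (cyc_type S p)"
proof -
  have "p x = x" using assms by (simp add: permutes_not_in)
  then have "orbit p x = {x}" by (simp add: orbit_eq_singleton_iff)
  then show ?thesis
    using cyc_type_orbit_split[of "insert x S" p x] assms permutes_imp_permutation[of S p] by simp
qed

lemma sum_mset_cyc_type:
  assumes "finite S" "p permutes S"
  shows "sum_mset (cyc_type S p) = card S"
proof -
  note P = permutes_imp_permutation[OF assms]
  have "sum_mset (cyc_type S p) = (\<Sum>C\<in>orbit p ` S. card C)"
    by (simp add: cyc_type_def sum_unfold_sum_mset)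
  also have "\<dots> = card (\<Union> (orbit p ` S))"
  proof (rule card_Union_disjoint[symmetric])
    show "pairwise disjnt (orbit p ` S)"
      unfolding pairwise_def disjnt_def using orbit_eq_of_mem[OF P] by (metis disjoint_iff imageE)
  qed (auto intro: finite_orbit_permutation P)
  also have "\<Union> (orbit p ` S) = S"
    using permutes_orbit_subset[OF assms(2)] permutation_self_in_orbit[OF P] by blast
  finally show ?thesis .
qed

lemma zero_notin_cyc_type:
  assumes "finite S" "p permutes S"
  shows "0 \<notin># cyc_type S p"
proof
  assume "0 \<in># cyc_type S p"
  then obtain b where "card (orbit p b) = 0"
    using assms(1) by (auto simp: cyc_type_def)
  then show False
    using card_orbit_pos[OF permutes_imp_permutation[OF assms], of b] by simp
qed

text \<open>A cycle of length \<open>k\<close> has \<open>k\<close> points, and each of them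
  contributes \<open>f k\<close>.\<close>

lemma sum_over_cycles:
  fixes f :: "nat \<Rightarrow> 'b::comm_semiring_1"
  assumes "finite S" "p permutes S"
  shows "(\<Sum>b\<in>S. f (card (orbit p b))) = (\<Sum>k\<in>#cyc_type S p. of_nat k * f k)"
proof -
  note P = permutes_imp_permutation[OF assms]
  have "(\<Sum>b\<in>S. f (card (orbit p b))) =
      (\<Sum>C\<in>orbit p ` S. \<Sum>b\<in>{b\<in>S. orbit p b = C}. f (card (orbit p b)))"
    by (rule sum.image_gen[OF assms(1)])
  also have "\<dots> = (\<Sum>C\<in>orbit p ` S. of_nat (card C) * f (card C))"
  proof (rule sum.cong)
    fix C assume C: "C \<in> orbit p ` S"
    then have "{b \<in> S. orbit p b = C} = C"
      using permutes_orbit_subset[OF assms(2)] permutation_self_in_orbit[OF P] orbit_eq_of_mem[OF P]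
      by blast
    then have "(\<Sum>b\<in>{b\<in>S. orbit p b = C}. f (card (orbit p b))) = (\<Sum>b\<in>{b\<in>S. orbit p b = C}. f (card C))"
      by (intro sum.cong) auto
    then show "(\<Sum>b\<in>{b\<in>S. orbit p b = C}. f (card (orbit p b))) = of_nat (card C) * f (card C)"
      using \<open>{b \<in> S. orbit p b = C} = C\<close> by simp
  qed simp
  also have "\<dots> = (\<Sum>k\<in>#cyc_type S p. of_nat k * f k)"
    by (simp add: cyc_type_def sum_unfold_sum_mset image_mset.compositionality comp_def)
  finally show ?thesis .
qed

section \<open>The cut-and-join equation\<close>

definition cyc_weight :: "nat multiset \<Rightarrow> complex fps" where
  "cyc_weight \<beta> = (\<Prod>k\<in>#\<beta>. 1 - fps_X ^ k)"

text \<open>The geometric series in \<open>fps_X ^ k\<close>. It enters most identities below only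
  through the relation \<open>geom_mult\<close>, which leaves them to
  \<open>algebra\<close>.\<close>

definition geom :: "nat \<Rightarrow> complex fps" where
  "geom k = inverse (1 - fps_X ^ k)"

lemma geom_mult: "k > 0 \<Longrightarrow> geom k * (1 - fps_X ^ k) = 1"
  unfolding geom_def by (rule inverse_mult_eq_1) simp

lemma cyc_weight_add_mset [simp]: "cyc_weight (add_mset k \<beta>) = (1 - fps_X ^ k) * cyc_weight \<beta>"
  and cyc_weight_empty [simp]: "cyc_weight {#} = 1"
  by (simp_all add: cyc_weight_def)

text \<open>A logarithmic derivative: for the factor \<open>1 - fps_X ^ k\<close> it equals
  \<open>- k * fps_X ^ k * geom k = k * (1 - geom k)\<close>, and these terms add up over the
  parts.\<close>

lemma fps_X_deriv_cyc_weight: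
  assumes "0 \<notin># \<beta>"
  shows "fps_X * fps_deriv (cyc_weight \<beta>) =
    cyc_weight \<beta> * (of_nat (sum_mset \<beta>) - (\<Sum>k\<in>#\<beta>. of_nat k * geom k))"
  using assms
proof (induction \<beta>)
  case (add k \<beta>)
  then have k: "k > 0" by auto
  define x :: "complex fps" where "x = fps_X ^ k"
  have "fps_X * fps_deriv (fps_X ^ k) = of_nat k * (fps_X ^ k :: complex fps)"
    by (induction k) (auto simp: algebra_simps)
  then have "fps_X * fps_deriv (1 - fps_X ^ k :: complex fps) = - of_nat k * x"
    by (simp add: x_def)
  also have "\<dots> = (1 - x) * (of_nat k * (1 - geom k))"
    using geom_mult[OF k, folded x_def] by algebra
  finally have D: "fps_X * fps_deriv (1 - fps_X ^ k :: complex fps) = (1 - fps_X ^ k) * (of_nat k * (1 - geom k))"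
    by (simp add: x_def)
  have "fps_X * fps_deriv (cyc_weight (add_mset k \<beta>)) =
     fps_X * fps_deriv (1 - fps_X ^ k) * cyc_weight \<beta> +
     (1 - fps_X ^ k) * (fps_X * fps_deriv (cyc_weight \<beta>))"
    by (simp only: cyc_weight_add_mset fps_deriv_mult distrib_left ac_simps)
  also have "\<dots> = (1 - fps_X ^ k) * cyc_weight \<beta> *
      (of_nat k * (1 - geom k) + (of_nat (sum_mset \<beta>) - (\<Sum>k\<in>#\<beta>. of_nat k * geom k)))"
  proof -
    have "fps_X * fps_deriv (cyc_weight \<beta>) =
        cyc_weight \<beta> * (of_nat (sum_mset \<beta>) - (\<Sum>k\<in>#\<beta>. of_nat k * geom k))"
      using add by simp
    then show ?thesis unfolding D by (simp only: distrib_left ac_simps)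
  qed
  finally show ?case by (simp add: algebra_simps)
qed simp

lemma sum_fps_X_powers: "(1 - fps_X) * (\<Sum>i=1..<Suc n. fps_X ^ i) = (fps_X - fps_X ^ Suc n :: complex fps)"
proof (induction n)
  case (Suc n)
  have "(\<Sum>i=1..<Suc (Suc n). fps_X ^ i) = (\<Sum>i=1..<Suc n. fps_X ^ i) + (fps_X ^ Suc n :: complex fps)"
    by (subst sum.atLeastLessThan_Suc) auto
  then show ?case using Suc by (simp only: distrib_left) (simp add: algebra_simps)
qed simp

text \<open>The total weight of all cuts of a cycle of length \<open>L\<close>, with
  \<open>geom L\<close> removing the factor of the old cycle. Each product expands to
  \<open>1 + fps_X ^ L\<close> minus two powers, and the two sums of powers agree under the
  reflection of \<open>i\<close> to \<open>L - i\<close>.\<close>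

lemma sum_cut_weights:
  assumes "L > 0"
  shows "(\<Sum>i=1..<L. geom L * ((1 - fps_X ^ i) * (1 - fps_X ^ (L - i)))) =
    2 * of_nat L * geom L + 1 - of_nat L - 2 * geom 1"
proof -
  obtain n where L: "L = Suc n" using assms by (cases L) auto
  define R :: "complex fps" where "R = (\<Sum>i=1..<L. fps_X ^ i)"
  define x :: "complex fps" where "x = fps_X ^ L"
  have R: "(1 - fps_X) * R = fps_X - x"
    unfolding R_def x_def L by (rule sum_fps_X_powers)
  have g1: "geom 1 * (1 - fps_X) = 1" and gL: "geom L * (1 - x) = 1"
    using geom_mult[of 1] geom_mult[OF assms] by (simp_all add: x_def)
  have R': "(\<Sum>i=1..<L. fps_X ^ (L - i)) = R"
    unfolding R_def by (rule sum.reindex_bij_witness[of _ "\<lambda>i. L - i" "\<lambda>i. L - i"]) auto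
  have "(1 - fps_X ^ i) * (1 - fps_X ^ (L - i)) = (1 + fps_X ^ L) - fps_X ^ i - (fps_X ^ (L - i) :: complex fps)"
    if "i \<in> {1..<L}" for i
  proof -
    have "fps_X ^ L = fps_X ^ i * (fps_X ^ (L - i) :: complex fps)"
      using that by (simp flip: power_add)
    then show ?thesis by (simp add: algebra_simps)
  qed
  then have "(\<Sum>i=1..<L. (1 - fps_X ^ i) * (1 - fps_X ^ (L - i) :: complex fps)) =
      (\<Sum>i=1..<L. (1 + x) - fps_X ^ i - fps_X ^ (L - i))"
    unfolding x_def by (intro sum.cong) auto
  also have "\<dots> = (of_nat L - 1) * (1 + x) - 2 * R"
    unfolding sum_subtractf R' R_def[symmetric] using L by simp
  finally have "(\<Sum>i=1..<L. (1 - fps_X ^ i) * (1 - fps_X ^ (L - i) :: complex fps)) =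
      (of_nat L - 1) * (1 + x) - 2 * R" .
  then have "(\<Sum>i=1..<L. geom L * ((1 - fps_X ^ i) * (1 - fps_X ^ (L - i)))) =
      geom L * ((of_nat L - 1) * (1 + x) - 2 * R)"
    by (simp only: sum_distrib_left[symmetric])
  \<comment> \<open>Partial fractions: \<open>fps_X - x = (1 - x) - (1 - fps_X)\<close>.\<close>
  moreover have "geom L * R = geom 1 - geom L"
  proof -
    have "R = geom 1 * (fps_X - x)"
      using R g1 by algebra
    then show ?thesis using g1 gL by algebra
  qed
  ultimately show ?thesis using gL by algebra
qed

text \<open>The relative weight of a join. It is the identity
  \<open>1 - x * y = (1 - x) + (1 - y) - (1 - x) * (1 - y)\<close> divided by
  \<open>(1 - x) * (1 - y)\<close>.\<close>

lemma join_weights: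
  assumes "L > 0" "M > 0"
  shows "geom L * geom M * (1 - fps_X ^ (L + M)) = geom L + geom M - 1"
proof -
  have "g * h * (1 - x * y) = g + h - 1"
    if "g * (1 - x) = 1" "h * (1 - y) = 1" for g h x y :: "complex fps"
    using that by algebra
  then show ?thesis
    using geom_mult assms unfolding power_add by blast
qed

text \<open>A point \<open>a\<close> in the cycle of \<open>b\<close> cuts this cycle; any other
  \<open>a\<close> joins its own cycle to it. When both contributions are added, the multiples of
  \<open>L\<close> cancel. The length survives only in \<open>card S * geom L\<close>, and the sum
  \<open>V\<close> over all points forms the logarithmic derivative of \<open>w\<close> together
  with \<open>card S\<close>.\<close>

lemma pointed_cut_join:
  assumes "finite S" "p permutes S" "b \<in> S"
  defines "w \<equiv> cyc_weight (cyc_type S p)"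
  shows "(\<Sum>a\<in>S - {b}. cyc_weight (cyc_type S (Transposition.transpose a b \<circ> p))) =
    w * (of_nat (card S) * geom (card (orbit p b)) + 1 - 2 * geom 1) - fps_X * fps_deriv w"
proof -
  define O' L where "O' = orbit p b" and "L = card O'"
  note P = permutes_imp_permutation[OF assms(1,2)]
  define W where "W = (\<lambda>a. cyc_weight (cyc_type S (Transposition.transpose a b \<circ> p)))"
  have L: "L > 0" unfolding L_def O'_def by (rule card_orbit_pos[OF P])
  have O': "O' \<subseteq> S" "b \<in> O'" "finite O'"
    unfolding O'_def using permutes_orbit_subset[OF assms(2,3)] permutation_self_in_orbit[OF P]
      finite_orbit_permutation[OF P] by auto
  define V :: "complex fps" where "V = (\<Sum>a\<in>S. geom (card (orbit p a)))"
  have V: "V = (\<Sum>k\<in>#cyc_type S p. of_nat k * geom k)"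
    unfolding V_def by (rule sum_over_cycles[OF assms(1,2)])
  have dw: "fps_X * fps_deriv w = w * (of_nat (card S) - V)"
    unfolding w_def V using fps_X_deriv_cyc_weight[OF zero_notin_cyc_type[OF assms(1,2)]]
    by (simp add: sum_mset_cyc_type[OF assms(1,2)])
  have cut: "sum W (O' - {b}) = w * (2 * of_nat L * geom L + 1 - of_nat L - 2 * geom 1)"
  proof -
    have inj: "inj_on (\<lambda>j. (p ^^ j) b) {..<L}" and im: "O' = (\<lambda>j. (p ^^ j) b) ` {..<L}"
      unfolding L_def O'_def using orbit_period(2,3)[OF P, of b] by auto
    \<comment> \<open>The index 0 stands for \<open>b\<close> itself, which the sum leaves
      out.\<close>
    have "{..<L} = insert 0 {1..<L}" using L by auto
    then have im': "O' - {b} = (\<lambda>j. (p ^^ j) b) ` {1..<L}"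
      using inj im L by (auto simp: inj_on_def)
    have "sum W (O' - {b}) = (\<Sum>i=1..<L. W ((p ^^ i) b))"
      unfolding im' using inj by (subst sum.reindex) (auto intro: inj_on_subset)
    also have "\<dots> = (\<Sum>i=1..<L. w * (geom L * ((1 - fps_X ^ i) * (1 - fps_X ^ (L - i)))))"
    proof (rule sum.cong)
      fix i assume i: "i \<in> {1..<L}"
      have "cyc_weight (add_mset L (cyc_type S (Transposition.transpose ((p ^^ i) b) b \<circ> p))) =
          cyc_weight (cyc_type S p + {#i, L - i#})"
        using cyc_type_cut[OF assms(1-3), of i] i by (simp add: L_def O'_def)
      then have "(1 - fps_X ^ L) * W ((p ^^ i) b) = w * ((1 - fps_X ^ i) * (1 - fps_X ^ (L - i)))"
        by (simp add: W_def w_def mult.assoc mult.commute)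
      then have "geom L * (1 - fps_X ^ L) * W ((p ^^ i) b) =
          geom L * (w * ((1 - fps_X ^ i) * (1 - fps_X ^ (L - i))))"
        by (simp only: mult.assoc)
      then show "W ((p ^^ i) b) = w * (geom L * ((1 - fps_X ^ i) * (1 - fps_X ^ (L - i))))"
        using geom_mult[OF L] by (simp add: mult.left_commute)
    qed simp
    finally show ?thesis by (simp only: sum_distrib_left[of w, symmetric] sum_cut_weights[OF L])
  qed
  have join: "sum W (S - O') = w * (of_nat (card S - L) * (geom L - 1) + V - of_nat L * geom L)"
  proof -
    have "sum W (S - O') = (\<Sum>a\<in>S - O'. w * (geom L + geom (card (orbit p a)) - 1))"
    proof (rule sum.cong)
      fix a assume a: "a \<in> S - O'"
      define M where "M = card (orbit p a)"
      have M: "M > 0" unfolding M_def by (rule card_orbit_pos[OF P])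
      have "cyc_weight (cyc_type S (Transposition.transpose a b \<circ> p) + {#L, M#}) =
          cyc_weight (add_mset (L + M) (cyc_type S p))"
        using cyc_type_join[OF assms(1-3), of a] a by (simp add: L_def O'_def M_def)
      then have "(1 - fps_X ^ L) * (1 - fps_X ^ M) * W a = w * (1 - fps_X ^ (L + M))"
        by (simp add: W_def w_def mult.assoc mult.commute mult.left_commute)
      then have "(geom L * (1 - fps_X ^ L)) * (geom M * (1 - fps_X ^ M)) * W a =
          w * (geom L * geom M * (1 - fps_X ^ (L + M)))"
        by (simp only: ac_simps)
      then have "W a = w * (geom L * geom M * (1 - fps_X ^ (L + M)))"
        using geom_mult[OF L] geom_mult[OF M] by simp
      then show "W a = w * (geom L + geom (card (orbit p a)) - 1)"
        using join_weights[OF L M] by (simp add: M_def)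
    qed simp
    also have "\<dots> = w * (of_nat (card (S - O')) * (geom L - 1) + (\<Sum>a\<in>S - O'. geom (card (orbit p a))))"
      by (simp add: sum_distrib_left[symmetric] sum.distrib sum_subtractf algebra_simps)
    also have "card (S - O') = card S - L"
      unfolding L_def using O' by (intro card_Diff_subset) auto
    also have "(\<Sum>a\<in>S - O'. geom (card (orbit p a))) = V - (\<Sum>a\<in>O'. geom (card (orbit p a)))"
      unfolding V_def using O' assms(1) by (intro sum_diff) auto
    also have "(\<Sum>a\<in>O'. geom (card (orbit p a))) = (\<Sum>a\<in>O'. geom L)"
      using orbit_eq_of_mem[OF P] by (intro sum.cong) (auto simp: L_def O'_def)
    finally show ?thesis by (simp add: L_def algebra_simps)
  qed
  have LS: "L \<le> card S" unfolding L_def using O' assms(1) by (intro card_mono)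
  have "sum W (S - {b}) = sum W (O' - {b}) + sum W (S - O')"
    using O' assms(1) by (subst sum.union_disjoint[symmetric]) (auto intro: sum.cong)
  also have "\<dots> = w * (of_nat (card S) * geom L + 1 - 2 * geom 1) - fps_X * fps_deriv w"
    unfolding cut join dw of_nat_diff[OF LS] by algebra
  finally show ?thesis by (simp add: W_def L_def O'_def)
qed

section \<open>Sums over all transpositions\<close>

definition transpositions :: "'a set \<Rightarrow> ('a \<Rightarrow> 'a) set" where
  "transpositions S = {Transposition.transpose a b | a b. a \<in> S \<and> b \<in> S \<and> a \<noteq> b}"

lemma transpose_eq_transpose_iff:
  assumes "a \<noteq> b" "c \<noteq> e"
  shows "Transposition.transpose c e = Transposition.transpose a b \<longleftrightarrow> c = a \<and> e = b \<or> c = b \<and> e = a"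
proof
  assume "Transposition.transpose c e = Transposition.transpose a b"
  then have "Transposition.transpose a b c = e" by (metis transpose_apply_first)
  then show "c = a \<and> e = b \<or> c = b \<and> e = a"
    using assms(2) by (auto simp: Transposition.transpose_def split: if_splits)
qed (auto simp: transpose_commute)

text \<open>Every transposition comes from exactly two ordered pairs of distinct points.\<close>

lemma twice_sum_transpositions:
  fixes f :: "('a \<Rightarrow> 'a) \<Rightarrow> 'b::comm_semiring_1"
  assumes "finite S"
  shows "2 * (\<Sum>\<tau>\<in>transpositions S. f \<tau>) = (\<Sum>b\<in>S. \<Sum>a\<in>S - {b}. f (Transposition.transpose a b))"
proof -
  define P where "P = (SIGMA b:S. S - {b})"
  define h where "h = (\<lambda>(b, a). Transposition.transpose a b :: 'a \<Rightarrow> 'a)"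
  have fin: "finite P" using assms by (simp add: P_def)
  have im: "h ` P = transpositions S"
    by (force simp: h_def P_def transpositions_def image_iff)
  have "(\<Sum>b\<in>S. \<Sum>a\<in>S - {b}. f (Transposition.transpose a b)) = (\<Sum>x\<in>P. f (h x))"
    unfolding P_def h_def using assms by (subst sum.Sigma) (auto intro!: sum.cong)
  also have "\<dots> = (\<Sum>\<tau>\<in>h ` P. \<Sum>x\<in>{x\<in>P. h x = \<tau>}. f (h x))"
    by (rule sum.image_gen[OF fin])
  also have "\<dots> = (\<Sum>\<tau>\<in>h ` P. 2 * f \<tau>)"
  proof (rule sum.cong)
    fix \<tau> assume "\<tau> \<in> h ` P"
    then obtain a b where ab: "a \<in> S" "b \<in> S" "a \<noteq> b" "\<tau> = Transposition.transpose a b"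
      by (auto simp: im transpositions_def)
    have "{x\<in>P. h x = \<tau>} = {(b, a), (a, b)}"
      using ab transpose_eq_transpose_iff[OF ab(3)] by (auto simp: P_def h_def)
    then show "(\<Sum>x\<in>{x\<in>P. h x = \<tau>}. f (h x)) = 2 * f \<tau>"
      using ab by (simp add: h_def transpose_commute mult_2)
  qed simp
  finally show ?thesis by (simp add: im sum_distrib_left)
qed

definition hook_weight :: "nat multiset \<Rightarrow> complex fps" where
  "hook_weight \<beta> = geom 1 * cyc_weight \<beta>"

lemma fps_X_geom1: "fps_X * geom 1 = geom 1 - 1"
  using geom_mult[of 1] by (simp add: algebra_simps)

lemma fps_deriv_geom1: "fps_deriv (geom 1) = geom 1 ^ 2"
proof -
  have g: "geom 1 * (1 - fps_X) = 1"
    using geom_mult[of 1] by simp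
  then have "fps_deriv (geom 1 * (1 - fps_X)) = 0"
    by (simp only: fps_deriv_1)
  then have "fps_deriv (geom 1) * (1 - fps_X) = geom 1"
    by simp
  with g show ?thesis by algebra
qed

lemma geom1_nth: "geom 1 $ n = 1"
  unfolding geom_def power_one_right fps_inverse_gp'[symmetric]
  by (subst fps_inverse_idempotent) auto

lemma fps_nth_X_deriv: "(fps_X * fps_deriv f) $ l = of_nat l * f $ l"
  by (cases l) auto

text \<open>Summing \<open>pointed_cut_join\<close> over \<open>b\<close> turns
  \<open>geom (card (orbit p b))\<close> into \<open>V\<close>, which is again expressed by the
  derivative of \<open>w\<close>. The remaining term with \<open>2 * geom 1\<close> disappears on
  passing from \<open>w\<close> to \<open>q = geom 1 * w\<close>, because
  \<open>fps_X * fps_deriv (geom 1) = (geom 1 - 1) * geom 1\<close>. This is the reason for dividing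
  by \<open>1 - X\<close>.\<close>

lemma twice_sum_hook_weight_transpositions:
  assumes "finite S" "p permutes S"
  defines "d \<equiv> of_nat (card S) :: complex fps" and "q \<equiv> hook_weight (cyc_type S p)"
  shows "2 * (\<Sum>\<tau>\<in>transpositions S. hook_weight (cyc_type S (\<tau> \<circ> p))) =
    d * ((d - 1) * q - 2 * (fps_X * fps_deriv q))"
proof -
  define w where "w = cyc_weight (cyc_type S p)"
  define V where "V = (\<Sum>b\<in>S. geom (card (orbit p b)))"
  have V: "V = (\<Sum>k\<in>#cyc_type S p. of_nat k * geom k)"
    unfolding V_def by (rule sum_over_cycles[OF assms(1,2)])
  have dw: "fps_X * fps_deriv w = w * (d - V)"
    unfolding w_def V d_def using fps_X_deriv_cyc_weight[OF zero_notin_cyc_type[OF assms(1,2)]]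
    by (simp add: sum_mset_cyc_type[OF assms(1,2)])
  have "2 * (\<Sum>\<tau>\<in>transpositions S. cyc_weight (cyc_type S (\<tau> \<circ> p))) =
      (\<Sum>b\<in>S. w * (d * geom (card (orbit p b)) + 1 - 2 * geom 1) - fps_X * fps_deriv w)"
    unfolding twice_sum_transpositions[OF assms(1)] w_def d_def
    by (intro sum.cong pointed_cut_join assms refl)
  also have "\<dots> = w * (d * V + d - 2 * d * geom 1) - d * (fps_X * fps_deriv w)"
    by (simp add: V_def d_def sum_subtractf sum.distrib sum_distrib_left[symmetric] algebra_simps)
  finally have "2 * (\<Sum>\<tau>\<in>transpositions S. cyc_weight (cyc_type S (\<tau> \<circ> p))) = \<dots>" .
  then have sum: "2 * (\<Sum>\<tau>\<in>transpositions S. hook_weight (cyc_type S (\<tau> \<circ> p))) =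
      geom 1 * (w * (d * V + d - 2 * d * geom 1) - d * (fps_X * fps_deriv w))"
    unfolding hook_weight_def by (simp add: sum_distrib_left[symmetric] mult.left_commute)
  have "fps_X * fps_deriv q = geom 1 * (fps_X * fps_deriv w) + (fps_X * geom 1) * geom 1 * w"
    by (simp add: q_def hook_weight_def w_def fps_deriv_geom1[unfolded One_nat_def] power2_eq_square algebra_simps)
  then have dq: "fps_X * fps_deriv q = geom 1 * (w * (d - V)) + (geom 1 - 1) * geom 1 * w"
    unfolding dw fps_X_geom1 .
  have q: "q = geom 1 * w" by (simp add: q_def hook_weight_def w_def)
  show ?thesis unfolding sum dw dq unfolding q by (simp add: algebra_simps)
qed

text \<open>The operator \<open>fps_X * fps_deriv\<close> is diagonal on coefficients. The resulting
  factor is the sum of the contents of the hook with arm \<open>d - 1 - l\<close> and leg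
  \<open>l\<close>, where \<open>d = card S\<close>.\<close>

lemma sum_hook_weight_transpositions_nth:
  assumes "finite S" "p permutes S"
  shows "(\<Sum>\<tau>\<in>transpositions S. hook_weight (cyc_type S (\<tau> \<circ> p)) $ l) =
    of_nat (card S) * ((of_nat (card S) - 1) / 2 - of_nat l) * hook_weight (cyc_type S p) $ l"
proof -
  define d where "d = (of_nat (card S) :: complex)"
  define q where "q = hook_weight (cyc_type S p)"
  define T where "T = (\<Sum>\<tau>\<in>transpositions S. hook_weight (cyc_type S (\<tau> \<circ> p)))"
  have "fps_const 2 * T = fps_const d * (fps_const (d - 1) * q - fps_const 2 * (fps_X * fps_deriv q))"
    using twice_sum_hook_weight_transpositions[OF assms]
    by (simp add: T_def d_def q_def numeral_fps_const fps_of_nat flip: fps_const_sub)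
  then have "(fps_const 2 * T) $ l = (fps_const d * (fps_const (d - 1) * q - fps_const 2 * (fps_X * fps_deriv q))) $ l"
    by (rule arg_cong)
  then have "2 * T $ l = d * ((d - 1) * q $ l - 2 * (of_nat l * q $ l))"
    by (simp only: fps_mult_left_const_nth fps_sub_nth fps_nth_X_deriv)
  then have "T $ l = d * ((d - 1) / 2 - of_nat l) * q $ l"
    by (simp add: field_simps)
  then show ?thesis by (simp add: T_def fps_sum_nth d_def q_def)
qed

section \<open>Products with a full cycle\<close>

text \<open>The case of a join in which one of the cycles is the fixed point \<open>x\<close>: it is
  inserted into the cycle of \<open>c\<close>.\<close>

lemma cyc_type_insert:
  assumes "finite S" "x \<notin> S" "q permutes S" "c \<in> S"
  shows "add_mset (card (orbit q c)) (cyc_type (insert x S) (Transposition.transpose x c \<circ> q)) =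
    add_mset (Suc (card (orbit q c))) (cyc_type S q)"
proof -
  have q: "q permutes insert x S" using assms by (intro permutes_imp_permutes_insert)
  have "x \<notin> orbit q c" using permutes_orbit_subset[OF assms(3,4)] assms(2) by auto
  moreover have "orbit q x = {x}"
    using assms by (simp add: orbit_eq_singleton_iff permutes_not_in)
  ultimately show ?thesis
    using cyc_type_join[OF _ q, of c x] cyc_type_fixpoint[OF assms(1-3)] assms by simp
qed

lemma size_cyc_type_insert:
  assumes "finite S" "x \<notin> S" "q permutes S" "c \<in> S"
  shows "size (cyc_type (insert x S) (Transposition.transpose x c \<circ> q)) = size (cyc_type S q)"
  using arg_cong[OF cyc_type_insert[OF assms], of size] by simp

definition single_cycles :: "'a set \<Rightarrow> ('a \<Rightarrow> 'a) set" where
  "single_cycles S = {\<sigma>. \<sigma> permutes S \<and> size (cyc_type S \<sigma>) = 1}"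

text \<open>The variable marking cycles is evaluated at natural numbers \<open>s\<close>, because
  the values, taken as coefficients of a power series, have a product formula
  (\<open>cycle_sum_fps\<close>).\<close>

definition cycle_sum :: "'a set \<Rightarrow> ('a \<Rightarrow> 'a) \<Rightarrow> nat \<Rightarrow> complex" where
  "cycle_sum S p s = (\<Sum>\<sigma>\<in>single_cycles S. of_nat s ^ size (cyc_type S (\<sigma> \<circ> p)))"

text \<open>Conjugation by \<open>q\<close> relabels the transposed points, and \<open>q\<close>
  fixes \<open>x\<close>.\<close>

lemma comp_transpose_fixed:
  assumes "q permutes S" "x \<notin> S"
  shows "q \<circ> Transposition.transpose x a = Transposition.transpose x (q a) \<circ> q"
proof
  fix y
  show "(q \<circ> Transposition.transpose x a) y = (Transposition.transpose x (q a) \<circ> q) y"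
    using permutes_not_in[OF assms] inj_eq[OF permutes_inj[OF assms(1)], of y x]
      inj_eq[OF permutes_inj[OF assms(1)], of y a]
    by (simp add: Transposition.transpose_def)
qed

text \<open>A full cycle on \<open>insert x S\<close> arises in exactly one way from a full cycle on
  \<open>S\<close> by inserting \<open>x\<close> directly after some point \<open>a\<close>.\<close>

lemma sum_single_cycles_insert:
  fixes f :: "('a \<Rightarrow> 'a) \<Rightarrow> 'b::comm_monoid_add"
  assumes "finite S" "x \<notin> S" "S \<noteq> {}"
  shows "sum f (single_cycles (insert x S)) =
    (\<Sum>\<sigma>\<in>single_cycles S. \<Sum>a\<in>S. f (\<sigma> \<circ> Transposition.transpose x a))"
proof -
  \<comment> \<open>Extends \<open>f\<close> by zero, so that the recursion over all permutations of
    \<open>insert x S\<close> applies.\<close>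
  define h where "h = (\<lambda>\<sigma>. if size (cyc_type (insert x S) \<sigma>) = 1 then f \<sigma> else 0)"
  have filter: "sum f' (single_cycles T) =
      (\<Sum>\<sigma> | \<sigma> permutes T. if size (cyc_type T \<sigma>) = 1 then f' \<sigma> else 0)" if "finite T"
    for T :: "'a set" and f' :: "('a \<Rightarrow> 'a) \<Rightarrow> 'b"
  proof -
    have "single_cycles T = {\<sigma> \<in> {\<sigma>. \<sigma> permutes T}. size (cyc_type T \<sigma>) = 1}"
      by (auto simp: single_cycles_def)
    then show ?thesis
      by (simp only: sum.inter_filter[OF finite_permutations[OF that]])
  qed
  have "sum f (single_cycles (insert x S)) = sum h {\<sigma>. \<sigma> permutes insert x S}"
    unfolding h_def using assms(1) by (intro filter) simp
  also have "\<dots> = (\<Sum>b\<in>insert x S. \<Sum>\<sigma> | \<sigma> permutes S. h (Transposition.transpose x b \<circ> \<sigma>))"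
    by (rule sum_over_permutations_insert[OF assms(1,2)])
  also have "\<dots> = (\<Sum>\<sigma> | \<sigma> permutes S. h \<sigma>) + (\<Sum>b\<in>S. \<Sum>\<sigma> | \<sigma> permutes S. h (Transposition.transpose x b \<circ> \<sigma>))"
    using assms by simp
  \<comment> \<open>These permutations fix \<open>x\<close> and have a further cycle in the nonempty
    set \<open>S\<close>.\<close>
  also have "(\<Sum>\<sigma> | \<sigma> permutes S. h \<sigma>) = 0"
  proof (rule sum.neutral, safe)
    fix \<sigma> assume \<sigma>: "\<sigma> permutes S"
    have "cyc_type S \<sigma> \<noteq> {#}"
      using assms by (auto simp: cyc_type_def mset_set_empty_iff)
    then show "h \<sigma> = 0"
      using cyc_type_fixpoint[OF assms(1,2) \<sigma>] by (simp add: h_def)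
  qed
  also have "(\<Sum>b\<in>S. \<Sum>\<sigma> | \<sigma> permutes S. h (Transposition.transpose x b \<circ> \<sigma>)) =
      (\<Sum>\<sigma> | \<sigma> permutes S. \<Sum>b\<in>S. h (Transposition.transpose x b \<circ> \<sigma>))"
    by (rule sum.swap)
  also have "\<dots> = (\<Sum>\<sigma> | \<sigma> permutes S. if size (cyc_type S \<sigma>) = 1 then
      (\<Sum>a\<in>S. f (\<sigma> \<circ> Transposition.transpose x a)) else 0)"
  proof (rule sum.cong, safe)
    fix \<sigma> assume \<sigma>: "\<sigma> permutes S"
    have "h (Transposition.transpose x b \<circ> \<sigma>) =
        (if size (cyc_type S \<sigma>) = 1 then f (Transposition.transpose x b \<circ> \<sigma>) else 0)" if "b \<in> S" for b
      using size_cyc_type_insert[OF assms(1,2) \<sigma> that] by (simp add: h_def)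
    then have "(\<Sum>b\<in>S. h (Transposition.transpose x b \<circ> \<sigma>)) =
        (if size (cyc_type S \<sigma>) = 1 then (\<Sum>b\<in>S. f (Transposition.transpose x b \<circ> \<sigma>)) else 0)"
      by simp
    \<comment> \<open>Reindexing by \<open>b = \<sigma> a\<close> lets the transposition pass to the
      right of \<open>\<sigma>\<close>, where it meets \<open>p\<close> in the products
      below.\<close>
    moreover have "(\<Sum>b\<in>S. f (Transposition.transpose x b \<circ> \<sigma>)) =
        (\<Sum>a\<in>S. f (Transposition.transpose x (\<sigma> a) \<circ> \<sigma>))"
      by (rule sum.reindex_bij_betw[symmetric]) (rule permutes_imp_bij[OF \<sigma>])
    moreover have "Transposition.transpose x (\<sigma> a) \<circ> \<sigma> = \<sigma> \<circ> Transposition.transpose x a" for a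
      by (rule comp_transpose_fixed[OF \<sigma> assms(2), symmetric])
    ultimately show "(\<Sum>b\<in>S. h (Transposition.transpose x b \<circ> \<sigma>)) =
        (if size (cyc_type S \<sigma>) = 1 then (\<Sum>a\<in>S. f (\<sigma> \<circ> Transposition.transpose x a)) else 0)"
      by simp
  qed
  also have "\<dots> = (\<Sum>\<sigma>\<in>single_cycles S. \<Sum>a\<in>S. f (\<sigma> \<circ> Transposition.transpose x a))"
    by (rule filter[OF assms(1), symmetric])
  finally show ?thesis by simp
qed

text \<open>Moved to the left, the transposition inserts \<open>x\<close> into an existing cycle of
  \<open>\<sigma> \<circ> p\<close>, so each of the \<open>card S\<close> positions leaves the
  number of cycles unchanged.\<close>

lemma cycle_sum_insert_fixed:
  assumes "finite S" "x \<notin> S" "S \<noteq> {}" "p permutes S"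
  shows "cycle_sum (insert x S) p s = of_nat (card S) * cycle_sum S p s"
proof -
  have "size (cyc_type (insert x S) (\<sigma> \<circ> Transposition.transpose x a \<circ> p)) = size (cyc_type S (\<sigma> \<circ> p))"
    if "\<sigma> \<in> single_cycles S" "a \<in> S" for \<sigma> a
  proof -
    have \<sigma>: "\<sigma> permutes S" using that by (simp add: single_cycles_def)
    have "\<sigma> \<circ> Transposition.transpose x a \<circ> p = Transposition.transpose x (\<sigma> a) \<circ> (\<sigma> \<circ> p)"
      using comp_transpose_fixed[OF \<sigma> assms(2)] by (simp add: comp_assoc)
    moreover have "\<sigma> a \<in> S" using \<sigma> that by (simp add: permutes_in_image)
    ultimately show ?thesis
      using size_cyc_type_insert[OF assms(1,2) permutes_compose[OF assms(4) \<sigma>]] by simp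
  qed
  then show ?thesis
    unfolding cycle_sum_def sum_single_cycles_insert[OF assms(1-3)]
    by (simp add: sum_distrib_left)
qed

text \<open>For \<open>a = b\<close> the two transpositions cancel and \<open>x\<close> is a new
  fixed point, which gives the factor \<open>s\<close>. For other \<open>a\<close> the product of
  \<open>(x a)\<close> and \<open>(x b)\<close> is that of \<open>(x b)\<close> and
  \<open>(a b)\<close>; here \<open>(x b)\<close>, moved to the left, only inserts \<open>x\<close>
  into a cycle, and \<open>(a b)\<close> changes \<open>p\<close>.\<close>

lemma cycle_sum_insert_moved:
  assumes "finite S" "x \<notin> S" "p permutes S" "b \<in> S"
  shows "cycle_sum (insert x S) (Transposition.transpose x b \<circ> p) s =
    of_nat s * cycle_sum S p s + (\<Sum>a\<in>S - {b}. cycle_sum S (Transposition.transpose a b \<circ> p) s)"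
proof -
  have ne: "S \<noteq> {}" using assms by auto
  have same: "size (cyc_type (insert x S) (\<sigma> \<circ> Transposition.transpose x b \<circ> (Transposition.transpose x b \<circ> p))) =
      Suc (size (cyc_type S (\<sigma> \<circ> p)))"
    if "\<sigma> \<in> single_cycles S" for \<sigma>
  proof -
    have \<sigma>: "\<sigma> permutes S" using that by (simp add: single_cycles_def)
    have "\<sigma> \<circ> Transposition.transpose x b \<circ> (Transposition.transpose x b \<circ> p) = \<sigma> \<circ> p"
      by (simp add: fun_eq_iff)
    then show ?thesis
      using cyc_type_fixpoint[OF assms(1,2) permutes_compose[OF assms(3) \<sigma>]] by simp
  qed
  have diff: "size (cyc_type (insert x S) (\<sigma> \<circ> Transposition.transpose x a \<circ> (Transposition.transpose x b \<circ> p))) =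
      size (cyc_type S (\<sigma> \<circ> (Transposition.transpose a b \<circ> p)))"
    if "\<sigma> \<in> single_cycles S" "a \<in> S - {b}" for \<sigma> a
  proof -
    have \<sigma>: "\<sigma> permutes S" using that by (simp add: single_cycles_def)
    have "Transposition.transpose x a \<circ> Transposition.transpose x b =
        Transposition.transpose x b \<circ> Transposition.transpose a b"
      using that assms by (auto simp: fun_eq_iff Transposition.transpose_def)
    then have "\<sigma> \<circ> Transposition.transpose x a \<circ> (Transposition.transpose x b \<circ> p) =
        \<sigma> \<circ> Transposition.transpose x b \<circ> (Transposition.transpose a b \<circ> p)"
      by (simp only: o_assoc) (simp only: comp_assoc)
    also have "\<dots> = Transposition.transpose x (\<sigma> b) \<circ> (\<sigma> \<circ> (Transposition.transpose a b \<circ> p))"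
      using comp_transpose_fixed[OF \<sigma> assms(2)] by (simp add: comp_assoc)
    finally have "\<sigma> \<circ> Transposition.transpose x a \<circ> (Transposition.transpose x b \<circ> p) = \<dots>" .
    moreover have "\<sigma> b \<in> S" using \<sigma> assms by (simp add: permutes_in_image)
    moreover have "\<sigma> \<circ> (Transposition.transpose a b \<circ> p) permutes S"
      using assms that \<sigma> by (intro permutes_compose[OF permutes_transpose_comp]) auto
    ultimately show ?thesis
      using size_cyc_type_insert[OF assms(1,2)] by simp
  qed
  have "cycle_sum (insert x S) (Transposition.transpose x b \<circ> p) s =
      (\<Sum>\<sigma>\<in>single_cycles S. of_nat s * of_nat s ^ size (cyc_type S (\<sigma> \<circ> p)) +
        (\<Sum>a\<in>S - {b}. of_nat s ^ size (cyc_type S (\<sigma> \<circ> (Transposition.transpose a b \<circ> p)))))"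
    unfolding cycle_sum_def sum_single_cycles_insert[OF assms(1,2) ne]
  proof (intro sum.cong refl)
    fix \<sigma> assume \<sigma>: "\<sigma> \<in> single_cycles S"
    show "(\<Sum>a\<in>S. of_nat s ^ size (cyc_type (insert x S)
          (\<sigma> \<circ> Transposition.transpose x a \<circ> (Transposition.transpose x b \<circ> p)))) =
        of_nat s * of_nat s ^ size (cyc_type S (\<sigma> \<circ> p)) +
        (\<Sum>a\<in>S - {b}. (of_nat s :: complex) ^ size (cyc_type S (\<sigma> \<circ> (Transposition.transpose a b \<circ> p))))"
      using same[OF \<sigma>] diff[OF \<sigma>] by (subst sum.remove[OF assms(1,4)]) simp
  qed
  also have "\<dots> = of_nat s * cycle_sum S p s + (\<Sum>a\<in>S - {b}. cycle_sum S (Transposition.transpose a b \<circ> p) s)"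
    unfolding cycle_sum_def sum.distrib sum_distrib_left by (subst sum.swap[of _ "S - {b}"]) simp
  finally show ?thesis .
qed

text \<open>Induction on the set by removing \<open>x\<close> from its cycle under \<open>p\<close>.
  If \<open>p\<close> moves \<open>x\<close>, the recursion of \<open>cycle_sum_insert_moved\<close>
  is a cut-and-join sum at \<open>b = p x\<close>, which \<open>pointed_cut_join\<close>
  evaluates.\<close>

lemma cycle_sum_fps:
  assumes "finite S" "S \<noteq> {}" "p permutes S"
  shows "Abs_fps (cycle_sum S p) =
    of_nat (fact (card S - 1)) * fps_X * cyc_weight (cyc_type S p) * geom 1 ^ (card S + 2)"
  using assms
proof (induction S arbitrary: p rule: finite_ne_induct)
  case (singleton x)
  then have p: "p = id" by (auto simp: permutes_sing)
  have ct: "cyc_type {x} id = {#1#}"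
    using orbit_eq_singleton_iff[of id x] by (simp add: cyc_type_def)
  have "single_cycles {x} = {id}"
    using ct by (auto simp: single_cycles_def permutes_sing)
  then have cs: "cycle_sum {x} p s = of_nat s" for s
    using ct p by (simp add: cycle_sum_def)
  have "Abs_fps (cycle_sum {x} p) = fps_X * fps_deriv (geom 1)"
    by (rule fps_ext) (simp only: fps_nth_X_deriv cs fps_nth_Abs_fps geom1_nth mult_1_right)
  also have "\<dots> = fps_X * geom 1 ^ 2" by (simp only: fps_deriv_geom1)
  \<comment> \<open>The factor \<open>1 - fps_X\<close> is the weight of the single cycle of length
    1; it raises the exponent to \<open>card {x} + 2 = 3\<close>.\<close>
  also have "\<dots> = fps_X * (1 - fps_X) * geom 1 ^ 3"
    using fps_X_geom1 by algebra
  finally show ?case unfolding p ct by (simp add: numeral_3_eq_3 id_def)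
next
  case (insert x S)
  define e where "e = card S"
  have e: "e > 0" using insert by (simp add: e_def card_gt_0_iff)
  then have fe: "of_nat (fact e) = of_nat e * (of_nat (fact (e - 1)) :: complex fps)"
    by (subst fact_reduce) auto
  \<comment> \<open>Here \<open>p'\<close> is \<open>p\<close> with \<open>x\<close> taken out of
    its cycle, and \<open>b\<close> is the point that followed \<open>x\<close>.\<close>
  define b p' where "b = p x" and "p' = Transposition.transpose x b \<circ> p"
  have p': "p' permutes S"
    unfolding p'_def b_def using insert.prems by (intro permutes_insert_lemma)
  have p: "p = Transposition.transpose x b \<circ> p'" by (simp add: p'_def fun_eq_iff)
  define w where "w = cyc_weight (cyc_type S p')"
  define G where "G = geom 1 ^ (e + 2)"
  define k where "k = (of_nat (fact (e - 1)) :: complex fps)"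
  have g1: "geom 1 * (1 - fps_X) = 1" using geom_mult[of 1] by simp
  have card: "card (insert x S) = Suc e" using insert by (simp add: e_def)
  show ?case
  proof (cases "b = x")
    case True
    then have "p = p'" using p by simp
    have "Abs_fps (cycle_sum (insert x S) p) = of_nat e * Abs_fps (cycle_sum S p')"
      unfolding \<open>p = p'\<close> e_def using cycle_sum_insert_fixed[OF insert(1,3,2) p']
      by (intro fps_ext) (simp flip: fps_of_nat)
    also have "\<dots> = of_nat (fact e) * fps_X * w * G"
      unfolding fe insert.IH[OF p'] by (simp add: w_def G_def e_def mult.assoc)
    also have "\<dots> = of_nat (fact e) * fps_X * ((1 - fps_X) * w) * (geom 1 * G)"
      using g1 by algebra
    finally show ?thesis
      using cyc_type_fixpoint[OF insert(1,3) p'] \<open>p = p'\<close> unfolding card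
      by (simp add: w_def G_def)
  next
    case False
    then have b: "b \<in> S"
      using permutes_in_image[OF insert.prems, of x] unfolding b_def by simp
    define L where "L = card (orbit p' b)"
    have L: "L > 0" unfolding L_def by (rule card_orbit_pos[OF permutes_imp_permutation[OF insert(1) p']])
    have IH: "Abs_fps (cycle_sum S q) = k * fps_X * cyc_weight (cyc_type S q) * G" if "q permutes S" for q
      using insert.IH[OF that] by (simp add: k_def G_def e_def)
    \<comment> \<open>The factor \<open>s\<close> on the coefficients becomes \<open>fps_X\<close>
      times the derivative.\<close>
    have "Abs_fps (cycle_sum (insert x S) p) = fps_X * fps_deriv (Abs_fps (cycle_sum S p')) +
        (\<Sum>a\<in>S - {b}. Abs_fps (cycle_sum S (Transposition.transpose a b \<circ> p')))"
      by (rule fps_ext) (simp only: p cycle_sum_insert_moved[OF insert(1,3) p' b] fps_nth_Abs_fps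
            fps_add_nth fps_nth_X_deriv fps_sum_nth)
    also have "(\<Sum>a\<in>S - {b}. Abs_fps (cycle_sum S (Transposition.transpose a b \<circ> p'))) =
        (\<Sum>a\<in>S - {b}. (k * fps_X * G) * cyc_weight (cyc_type S (Transposition.transpose a b \<circ> p')))"
      using b by (intro sum.cong refl) (subst IH[OF permutes_transpose_comp[OF p']], auto)
    also have "\<dots> = (k * fps_X * G) * (w * (of_nat e * geom L + 1 - 2 * geom 1) - fps_X * fps_deriv w)"
      unfolding sum_distrib_left[symmetric] pointed_cut_join[OF insert(1) p' b] by (simp add: w_def e_def L_def)
    also have "fps_X * fps_deriv (Abs_fps (cycle_sum S p')) = fps_X * fps_deriv (k * fps_X * w * G)"
      by (simp only: IH[OF p'] w_def)
    also have "\<dots> = k * fps_X * (w * G + (fps_X * fps_deriv w) * G + w * (fps_X * fps_deriv G))"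
    proof -
      have "fps_deriv k = 0" unfolding k_def by (rule fps_deriv_of_nat)
      then show ?thesis by (simp add: algebra_simps)
    qed
    also have "fps_X * fps_deriv G = (of_nat e + 2) * G * (geom 1 - 1)"
    proof -
      have "fps_deriv G = of_nat (e + 2) * geom 1 ^ 2 * geom 1 ^ (e + 1)"
        unfolding G_def fps_deriv_power' fps_deriv_geom1 by simp
      then have "fps_X * fps_deriv G = (of_nat e + 2) * G * (fps_X * geom 1)"
        by (simp add: G_def power2_eq_square algebra_simps)
      then show ?thesis by (simp only: fps_X_geom1)
    qed
    also have "k * fps_X * (w * G + fps_X * fps_deriv w * G + w * ((of_nat e + 2) * G * (geom 1 - 1))) +
        k * fps_X * G * (w * (of_nat e * geom L + 1 - 2 * geom 1) - fps_X * fps_deriv w) =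
        (of_nat e * k) * fps_X * w * G * (geom 1 + geom L - 1)"
      by (simp add: algebra_simps)
    \<comment> \<open>The join identity for the point \<open>x\<close> and the cycle of
      \<open>b\<close>; it exchanges the weight of length \<open>L\<close> for that of length
      \<open>Suc L\<close>.\<close>
    also have "geom 1 + geom L - 1 = geom 1 * (geom L * (1 - fps_X ^ Suc L))"
      using join_weights[of 1 L] L by (simp add: mult.assoc)
    also have "of_nat e * k = of_nat (fact e)" by (simp only: fe k_def)
    also have "of_nat (fact e) * fps_X * w * G * (geom 1 * (geom L * (1 - fps_X ^ Suc L))) =
        of_nat (fact e) * fps_X * (geom L * ((1 - fps_X ^ Suc L) * w)) * (geom 1 * G)"
      by (simp only: ac_simps)
    also have "(1 - fps_X ^ Suc L) * w = (1 - fps_X ^ L) * cyc_weight (cyc_type (insert x S) p)"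
      using arg_cong[OF cyc_type_insert[OF insert(1,3) p' b], of cyc_weight]
      by (simp only: cyc_weight_add_mset w_def L_def p)
    also have "geom L * \<dots> = cyc_weight (cyc_type (insert x S) p)"
      using geom_mult[OF L] by (simp flip: mult.assoc)
    finally show ?thesis
      unfolding card by (simp add: G_def)
  qed
qed

section \<open>Polynomial form of the weights\<close>

definition cyc_poly :: "nat multiset \<Rightarrow> complex poly" where
  "cyc_poly \<beta> = (\<Prod>k\<in>#\<beta>. 1 - monom 1 k)"

text \<open>The polynomial counterpart of \<open>hook_weight\<close>, which can be evaluated at
  \<open>exp (- u)\<close>. The division by \<open>1 - X\<close> is exact for a nonempty multiset,
  since every factor vanishes at 1.\<close>

definition hook_poly :: "nat multiset \<Rightarrow> complex poly" where
  "hook_poly \<beta> = cyc_poly \<beta> div [:1, -1:]"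

lemma poly_cyc_poly: "poly (cyc_poly \<beta>) z = (\<Prod>k\<in>#\<beta>. 1 - z ^ k)"
  by (simp add: cyc_poly_def poly_prod_mset poly_monom)

lemma hook_poly_mult:
  assumes "\<beta> \<noteq> {#}"
  shows "hook_poly \<beta> * [:1, -1:] = cyc_poly \<beta>"
proof -
  obtain k \<gamma> where \<beta>: "\<beta> = add_mset k \<gamma>"
    using assms by (cases \<beta>) auto
  have "poly (cyc_poly \<beta>) 1 = 0"
    by (simp add: poly_cyc_poly \<beta>)
  then have "[:-1, 1:] dvd cyc_poly \<beta>"
    by (simp add: poly_eq_0_iff_dvd)
  then have "- [:-1, 1:] dvd cyc_poly \<beta>"
    by (simp only: minus_dvd_iff)
  then show ?thesis unfolding hook_poly_def by (intro dvd_div_mult_self) simp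
qed

lemma poly_hook_poly:
  assumes "\<beta> \<noteq> {#}"
  shows "poly (hook_poly \<beta>) z * (1 - z) = (\<Prod>k\<in>#\<beta>. 1 - z ^ k)"
  using arg_cong[OF hook_poly_mult[OF assms], of "\<lambda>p. poly p z"] by (simp add: poly_cyc_poly algebra_simps)

lemma fps_of_poly_cyc_poly: "fps_of_poly (cyc_poly \<beta>) = cyc_weight \<beta>"
  by (induction \<beta>) (simp_all add: cyc_poly_def fps_of_poly_mult fps_of_poly_diff fps_of_poly_monom')

lemma hook_weight_eq_hook_poly:
  assumes "\<beta> \<noteq> {#}"
  shows "hook_weight \<beta> = fps_of_poly (hook_poly \<beta>)"
proof -
  have "fps_of_poly [:1, -1:] = (1 - fps_X :: complex fps)"
    by (rule fps_ext) (auto simp: coeff_pCons fps_X_def split: nat.splits)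
  then have "fps_of_poly (hook_poly \<beta>) * (1 - fps_X) = cyc_weight \<beta>"
    using arg_cong[OF hook_poly_mult[OF assms], of fps_of_poly]
    by (simp only: fps_of_poly_mult fps_of_poly_cyc_poly)
  moreover have "geom 1 * (1 - fps_X) = 1"
    using geom_mult[of 1] by simp
  ultimately show ?thesis
    unfolding hook_weight_def by (metis mult.commute mult.left_commute mult.right_neutral)
qed

text \<open>The product has degree at most the sum of the parts, and dividing by
  \<open>1 - X\<close> lowers its degree by one. Sums over \<open>l < d\<close> therefore contain
  all coefficients.\<close>

lemma degree_hook_poly:
  assumes "\<beta> \<noteq> {#}" "0 \<notin># \<beta>"
  shows "degree (hook_poly \<beta>) < sum_mset \<beta>"
proof -
  have "cyc_poly \<beta> \<noteq> 0 \<and> degree (cyc_poly \<beta>) \<le> sum_mset \<beta>"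
    using assms(2)
  proof (induction \<beta>)
    case (add k \<beta>)
    have "coeff (1 - monom 1 k :: complex poly) k = -1"
      using add by (auto simp: coeff_1)
    then have "(1 - monom 1 k :: complex poly) \<noteq> 0" by force
    moreover have "degree (1 - monom 1 k :: complex poly) \<le> k"
      by (intro degree_diff_le) (auto simp: degree_monom_le)
    ultimately show ?case
      using add degree_mult_le[of "1 - monom 1 k :: complex poly" "cyc_poly \<beta>"]
      by (auto simp: cyc_poly_def)
  qed (simp add: cyc_poly_def)
  moreover have "degree (cyc_poly \<beta>) = degree (hook_poly \<beta>) + 1" if "cyc_poly \<beta> \<noteq> 0"
  proof -
    have "hook_poly \<beta> \<noteq> 0" using that hook_poly_mult[OF assms(1)] by auto
    then show ?thesis
      unfolding hook_poly_mult[OF assms(1), symmetric] by (subst degree_mult_eq) auto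
  qed
  ultimately show ?thesis by linarith
qed

text \<open>Multiplying by \<open>geom 1\<close> takes partial sums of coefficients, which the
  hockey-stick identity evaluates.\<close>

lemma geom1_power_nth: "(geom 1 ^ Suc d) $ n = of_nat ((n + d) choose d)"
proof (induction d arbitrary: n)
  case (Suc d)
  have "(geom 1 ^ Suc (Suc d)) $ n = (\<Sum>i\<le>n. of_nat ((n - i + d) choose d))"
    unfolding power_Suc[of _ "Suc d"] fps_mult_nth geom1_nth Suc by (simp add: atLeast0AtMost)
  also have "\<dots> = of_nat (\<Sum>i\<le>n. (d + i) choose d)"
    unfolding of_nat_sum by (rule sum.reindex_bij_witness[of _ "\<lambda>i. n - i" "\<lambda>i. n - i"]) (auto simp: add.commute)
  also have "\<dots> = of_nat ((d + n + 1) choose (d + 1))"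
    by (simp only: choose_rising_sum(1))
  finally show ?case by (simp add: ac_simps)
qed (simp add: geom1_nth[unfolded One_nat_def])

section \<open>Words of transpositions between a full cycle and a fixed permutation\<close>

definition word_sum :: "'a set \<Rightarrow> nat \<Rightarrow> ('a \<Rightarrow> 'a) \<Rightarrow> nat \<Rightarrow> complex" where
  "word_sum S t p s = (\<Sum>\<sigma>\<in>single_cycles S. \<Sum>ts\<in>{ts. set ts \<subseteq> transpositions S \<and> length ts = t}.
     of_nat s ^ size (cyc_type S (\<sigma> \<circ> foldr (\<circ>) ts id \<circ> p)))"

lemma finite_transpositions: "finite S \<Longrightarrow> finite (transpositions S)"
proof -
  assume "finite S"
  then have "finite ((\<lambda>(a, b). Transposition.transpose a b) ` (S \<times> S))" by blast
  then show ?thesis by (rule finite_subset[rotated]) (auto simp: transpositions_def)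
qed

lemma foldr_comp_snoc: "foldr (\<circ>) (ts @ [\<tau>]) id = foldr (\<circ>) ts id \<circ> \<tau>"
  by (induction ts) (simp_all add: comp_assoc)

text \<open>The last letter of the word stands next to \<open>p\<close> and is absorbed into
  it.\<close>

lemma word_sum_Suc:
  "word_sum S (Suc t) p s = (\<Sum>\<tau>\<in>transpositions S. word_sum S t (\<tau> \<circ> p) s)"
proof -
  define W where "W t = {ts. set ts \<subseteq> transpositions S \<and> length ts = t}" for t
  have bij: "bij_betw (\<lambda>(\<tau>, ts). ts @ [\<tau>]) (transpositions S \<times> W t) (W (Suc t))"
    by (rule bij_betw_byWitness[where f' = "\<lambda>ts. (last ts, butlast ts)"])
       (auto simp: W_def length_Suc_conv_rev)
  have snoc: "(\<Sum>ts\<in>W (Suc t). f ts) = (\<Sum>\<tau>\<in>transpositions S. \<Sum>ts\<in>W t. f (ts @ [\<tau>]))"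
    for f :: "('a \<Rightarrow> 'a) list \<Rightarrow> complex"
    using sum.reindex_bij_betw[OF bij, of f]
    by (simp add: sum.cartesian_product case_prod_unfold)
  show ?thesis
    unfolding word_sum_def W_def[symmetric] snoc foldr_comp_snoc comp_assoc by (rule sum.swap)
qed

text \<open>In the case of no letters, only \<open>hook_weight\<close> depends on \<open>p\<close>,
  and linearly. Each further letter then multiplies its \<open>l\<close>-th coefficient by the
  factor of \<open>sum_hook_weight_transpositions_nth\<close>.\<close>

lemma word_sum_fps:
  assumes "finite S" "S \<noteq> {}" "p permutes S"
  defines "d \<equiv> card S"
  shows "Abs_fps (word_sum S t p) = of_nat (fact (d - 1)) * fps_X * geom 1 ^ (d + 1) *
    Abs_fps (\<lambda>l. (of_nat d * ((of_nat d - 1) / 2 - of_nat l)) ^ t * hook_weight (cyc_type S p) $ l)"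
  using assms(3)
proof (induction t arbitrary: p)
  case 0
  have "{ts. set ts \<subseteq> transpositions S \<and> length ts = 0} = {[]}" by auto
  then have "word_sum S 0 p = cycle_sum S p"
    by (simp add: word_sum_def cycle_sum_def fun_eq_iff)
  \<comment> \<open>One of the \<open>d + 2\<close> factors \<open>geom 1\<close> goes into
    \<open>hook_weight\<close>.\<close>
  then show ?case
    using cycle_sum_fps[OF assms(1,2) 0]
    by (simp add: d_def hook_weight_def fps_nth_inverse mult_ac)
next
  case (Suc t)
  define \<mu> where "\<mu> = (\<lambda>l. of_nat d * ((of_nat d - 1) / 2 - of_nat l) :: complex)"
  have "Abs_fps (word_sum S (Suc t) p) = (\<Sum>\<tau>\<in>transpositions S. Abs_fps (word_sum S t (\<tau> \<circ> p)))"
    by (rule fps_ext) (simp add: fps_sum_nth word_sum_Suc)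
  also have "\<dots> = (\<Sum>\<tau>\<in>transpositions S. of_nat (fact (d - 1)) * fps_X * geom 1 ^ (d + 1) *
      Abs_fps (\<lambda>l. \<mu> l ^ t * hook_weight (cyc_type S (\<tau> \<circ> p)) $ l))"
  proof (rule sum.cong)
    fix \<tau> assume "\<tau> \<in> transpositions S"
    then obtain a b where "\<tau> = Transposition.transpose a b" "a \<in> S" "b \<in> S"
      by (auto simp: transpositions_def)
    then have "\<tau> \<circ> p permutes S"
      using permutes_transpose_comp[OF Suc.prems] by blast
    then show "Abs_fps (word_sum S t (\<tau> \<circ> p)) = of_nat (fact (d - 1)) * fps_X * geom 1 ^ (d + 1) *
        Abs_fps (\<lambda>l. \<mu> l ^ t * hook_weight (cyc_type S (\<tau> \<circ> p)) $ l)"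
      unfolding \<mu>_def by (rule Suc.IH)
  qed simp
  also have "\<dots> = of_nat (fact (d - 1)) * fps_X * geom 1 ^ (d + 1) *
      (\<Sum>\<tau>\<in>transpositions S. Abs_fps (\<lambda>l. \<mu> l ^ t * hook_weight (cyc_type S (\<tau> \<circ> p)) $ l))"
    by (simp only: sum_distrib_left)
  also have "(\<Sum>\<tau>\<in>transpositions S. Abs_fps (\<lambda>l. \<mu> l ^ t * hook_weight (cyc_type S (\<tau> \<circ> p)) $ l)) =
      Abs_fps (\<lambda>l. \<mu> l ^ Suc t * hook_weight (cyc_type S p) $ l)"
  proof (rule fps_ext)
    fix l
    have "(\<Sum>\<tau>\<in>transpositions S. hook_weight (cyc_type S (\<tau> \<circ> p)) $ l) = \<mu> l * hook_weight (cyc_type S p) $ l"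
      unfolding \<mu>_def d_def by (rule sum_hook_weight_transpositions_nth[OF assms(1) Suc.prems])
    then show "(\<Sum>\<tau>\<in>transpositions S. Abs_fps (\<lambda>l. \<mu> l ^ t * hook_weight (cyc_type S (\<tau> \<circ> p)) $ l)) $ l =
        Abs_fps (\<lambda>l. \<mu> l ^ Suc t * hook_weight (cyc_type S p) $ l) $ l"
      by (simp add: fps_sum_nth sum_distrib_left[symmetric])
  qed
  finally show ?case unfolding \<mu>_def .
qed

text \<open>The falling factorial of \<open>X + k\<close> of length \<open>d\<close>. It is the link
  between the two sides: at natural numbers it is a multiple of a binomial coefficient, and it is
  the factor produced by differentiating a power with exponent \<open>k + X\<close> exactly
  \<open>d\<close> times.\<close>

definition falling_poly :: "nat \<Rightarrow> nat \<Rightarrow> complex poly" where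
  "falling_poly d k = (\<Prod>c<d. [:of_nat k - of_nat c, 1:])"

lemma poly_falling_poly: "poly (falling_poly d k) (of_nat s) = of_nat (fact d) * of_nat ((s + k) choose d)"
proof -
  have "of_nat ((s + k) choose d) * fact d = (\<Prod>i<d. of_nat (s + k) - of_nat i :: complex)"
    unfolding binomial_gbinomial gbinomial_mult_fact' by (simp only: atLeast0LessThan)
  then show ?thesis
    unfolding falling_poly_def poly_prod by (simp add: algebra_simps)
qed

text \<open>Reads off the coefficient at \<open>s\<close> and rewrites it with a range of summation
  independent of \<open>s\<close>, so that it is visibly a polynomial in \<open>s\<close>.\<close>

lemma word_sum_eq:
  assumes "finite S" "S \<noteq> {}" "p permutes S" "s > 0"
  defines "d \<equiv> card S"
  shows "word_sum S t p s = (\<Sum>l<d. coeff (hook_poly (cyc_type S p)) l *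
    (of_nat d * ((of_nat d - 1) / 2 - of_nat l)) ^ t * poly (falling_poly d (d - 1 - l)) (of_nat s)) / of_nat d"
proof -
  define \<mu> where "\<mu> = (\<lambda>l. of_nat d * ((of_nat d - 1) / 2 - of_nat l) :: complex)"
  define h where "h = hook_poly (cyc_type S p)"
  have ne: "cyc_type S p \<noteq> {#}"
    using assms by (auto simp: cyc_type_def mset_set_empty_iff)
  have d: "d > 0" using assms by (simp add: d_def card_gt_0_iff)
  have deg: "degree h < d"
    unfolding h_def d_def using degree_hook_poly[OF ne zero_notin_cyc_type[OF assms(1,3)]]
    by (simp add: sum_mset_cyc_type[OF assms(1,3)])
  obtain n where s: "s = Suc n" using assms(4) by (cases s) auto
  have "word_sum S t p s = (of_nat (fact (d - 1)) * fps_X * geom 1 ^ (d + 1) *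
      Abs_fps (\<lambda>l. \<mu> l ^ t * coeff h l)) $ s"
    using arg_cong[OF word_sum_fps[OF assms(1-3), of t], of "\<lambda>f. f $ s"]
    by (simp only: hook_weight_eq_hook_poly[OF ne] fps_of_poly_nth \<mu>_def h_def d_def fps_nth_Abs_fps)
  also have "of_nat (fact (d - 1)) * fps_X * geom 1 ^ (d + 1) * Abs_fps (\<lambda>l. \<mu> l ^ t * coeff h l) =
      fps_const (of_nat (fact (d - 1))) * (fps_X * (Abs_fps (\<lambda>l. \<mu> l ^ t * coeff h l) * geom 1 ^ Suc d))"
    by (simp only: fps_of_nat Suc_eq_plus1 ac_simps)
  also have "\<dots> $ s = of_nat (fact (d - 1)) *
      (\<Sum>l\<le>n. \<mu> l ^ t * coeff h l * of_nat ((n - l + d) choose d))"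
    unfolding s fps_mult_left_const_nth fps_X_mult_nth fps_mult_nth[of "Abs_fps _"] geom1_power_nth
    by (simp add: atLeast0AtMost)
  \<comment> \<open>The terms with \<open>l \<ge> d\<close> vanish by the degree bound. For
    \<open>n < l < d\<close> the upper entry \<open>s + (d - 1 - l)\<close> is less than
    \<open>d\<close>, so the binomial coefficient is 0.\<close>
  also have "(\<Sum>l\<le>n. \<mu> l ^ t * coeff h l * of_nat ((n - l + d) choose d)) =
      (\<Sum>l<d. \<mu> l ^ t * coeff h l * of_nat ((s + (d - 1 - l)) choose d))"
  proof (rule sum.mono_neutral_cong)
    show "\<mu> l ^ t * coeff h l * of_nat ((s + (d - 1 - l)) choose d) = 0" if "l \<in> {..<d} - {..n}" for l
    proof -
      have "s + (d - 1 - l) < d" using that by (auto simp: s)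
      then show ?thesis by (simp add: binomial_eq_0)
    qed
    show "\<mu> l ^ t * coeff h l * of_nat ((n - l + d) choose d) = 0" if "l \<in> {..n} - {..<d}" for l
      using that deg by (simp add: coeff_eq_0)
    show "\<mu> l ^ t * coeff h l * of_nat ((n - l + d) choose d) =
        \<mu> l ^ t * coeff h l * of_nat ((s + (d - 1 - l)) choose d)" if "l \<in> {..n} \<inter> {..<d}" for l
    proof -
      have "n - l + d = s + (d - 1 - l)" using that by (auto simp: s)
      then show ?thesis by simp
    qed
  qed auto
  also have "of_nat (fact (d - 1)) * (\<Sum>l<d. \<mu> l ^ t * coeff h l * of_nat ((s + (d - 1 - l)) choose d)) =
      (\<Sum>l<d. coeff h l * \<mu> l ^ t * poly (falling_poly d (d - 1 - l)) (of_nat s)) / of_nat d"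
  proof -
    have "of_nat (fact d) = of_nat d * (of_nat (fact (d - 1)) :: complex)"
      using d by (subst fact_reduce) auto
    then show ?thesis
      using d unfolding poly_falling_poly sum_divide_distrib sum_distrib_left
      by (intro sum.cong) (auto simp: field_simps)
  qed
  finally show ?thesis by (simp add: \<mu>_def h_def)
qed

text \<open>The count and the formula are the \<open>m\<close>-th coefficients of two polynomials
  that agree at every positive integer \<open>s\<close>, hence are equal.\<close>

lemma card_factorizations:
  assumes "finite S" "S \<noteq> {}" "p permutes S"
  defines "d \<equiv> card S"
  shows "of_nat (card {(\<sigma>, ts). \<sigma> \<in> single_cycles S \<and> (set ts \<subseteq> transpositions S \<and> length ts = t) \<and>
      size (cyc_type S (\<sigma> \<circ> foldr (\<circ>) ts id \<circ> p)) = m}) =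
    (\<Sum>l<d. coeff (hook_poly (cyc_type S p)) l *
      (of_nat d * ((of_nat d - 1) / 2 - of_nat l)) ^ t * coeff (falling_poly d (d - 1 - l)) m) / of_nat d"
proof -
  define A where "A = single_cycles S \<times> {ts. set ts \<subseteq> transpositions S \<and> length ts = t}"
  define N where "N = (\<lambda>(\<sigma>, ts). size (cyc_type S (\<sigma> \<circ> foldr (\<circ>) ts id \<circ> p)))"
  have finA: "finite A"
    unfolding A_def single_cycles_def
    using finite_subset[OF _ finite_permutations[OF assms(1)]] finite_lists_length_eq[OF finite_transpositions[OF assms(1)]]
    by (intro finite_cartesian_product) auto
  define P :: "complex poly" where "P = (\<Sum>x\<in>A. monom 1 (N x))"
  define R where "R = smult (1 / of_nat d) (\<Sum>l<d. smult (coeff (hook_poly (cyc_type S p)) l *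
      (of_nat d * ((of_nat d - 1) / 2 - of_nat l)) ^ t) (falling_poly d (d - 1 - l)))"
  have eq: "poly P (of_nat s) = poly R (of_nat s)" if "s > 0" for s :: nat
  proof -
    have "poly P (of_nat s) = word_sum S t p s"
      unfolding P_def A_def N_def word_sum_def
      by (simp add: poly_sum poly_monom sum.cartesian_product case_prod_unfold)
    also have "\<dots> = poly R (of_nat s)"
      unfolding R_def using word_sum_eq[OF assms(1-3) that, of t]
      by (simp add: poly_sum d_def)
    finally show ?thesis .
  qed
  have "P - R = 0"
  proof (rule ccontr)
    assume "P - R \<noteq> 0"
    then have "finite {x. poly (P - R) x = 0}" by (rule poly_roots_finite)
    moreover have "range (\<lambda>n. of_nat (Suc n)) \<subseteq> {x. poly (P - R) x = 0}"
      using eq[of "Suc n" for n] by auto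
    ultimately have "finite (range (\<lambda>n. of_nat (Suc n) :: complex))" by (rule finite_subset[rotated])
    then have "finite (UNIV :: nat set)"
      by (rule finite_imageD) (simp only: inj_on_def of_nat_eq_iff nat.inject, simp)
    then show False by simp
  qed
  then have "coeff P m = coeff R m" by simp
  moreover have "coeff P m = of_nat (card {x \<in> A. N x = m})"
    unfolding P_def coeff_sum coeff_monom using finA by (simp flip: sum.inter_filter)
  moreover have "{x \<in> A. N x = m} = {(\<sigma>, ts). \<sigma> \<in> single_cycles S \<and>
      (set ts \<subseteq> transpositions S \<and> length ts = t) \<and> size (cyc_type S (\<sigma> \<circ> foldr (\<circ>) ts id \<circ> p)) = m}"
    by (auto simp: A_def N_def)
  ultimately show ?thesis
    by (simp add: R_def coeff_sum)
qed

section \<open>Sizes of conjugacy classes\<close>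

lemma Aut_add_mset: "Aut (add_mset k \<beta>) = Aut \<beta> * Suc (count \<beta> k)"
proof -
  define A where "A = set_mset \<beta> - {k}"
  have A: "finite A" "k \<notin> A" by (auto simp: A_def)
  have "(\<Prod>i\<in>A. fact (count (add_mset k \<beta>) i)) = (\<Prod>i\<in>A. fact (count \<beta> i) :: nat)"
    using A by (intro prod.cong) auto
  then have "Aut (add_mset k \<beta>) = fact (Suc (count \<beta> k)) * (\<Prod>i\<in>A. fact (count \<beta> i))"
    unfolding Aut_def using prod.insert_remove[of "set_mset \<beta>" "\<lambda>i. fact (count (add_mset k \<beta>) i) :: nat" k]
    by (simp add: A_def)
  moreover have "Aut \<beta> = fact (count \<beta> k) * (\<Prod>i\<in>A. fact (count \<beta> i))"
  proof (cases "k \<in># \<beta>")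
    case True
    then show ?thesis unfolding Aut_def A_def by (subst prod.remove[of _ k]) auto
  next
    case False
    then have "A = set_mset \<beta>" by (auto simp: A_def)
    then show ?thesis using False by (simp add: Aut_def count_eq_zero_iff[symmetric])
  qed
  ultimately show ?thesis by (simp add: algebra_simps)
qed

definition centralizer_order :: "nat multiset \<Rightarrow> nat" where
  "centralizer_order \<beta> = Aut \<beta> * prod_mset \<beta>"

lemma centralizer_order_add_mset:
  "centralizer_order (add_mset k \<beta>) = centralizer_order \<beta> * Suc (count \<beta> k) * k"
  by (simp add: centralizer_order_def Aut_add_mset algebra_simps)

lemma card_orbit_size_eq:
  assumes "finite S" "q permutes S"
  shows "card {b\<in>S. card (orbit q b) = k} = k * count (cyc_type S q) k"
proof -
  have "card {b\<in>S. card (orbit q b) = k} = (\<Sum>b\<in>S. if card (orbit q b) = k then 1 else 0)"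
    using assms by (simp flip: sum.inter_filter)
  also have "\<dots> = (\<Sum>i\<in>#cyc_type S q. of_nat i * (if i = k then 1 else 0))"
    by (rule sum_over_cycles[OF assms])
  also have "\<dots> = k * count (cyc_type S q) k"
  proof -
    have "(\<Sum>i\<in>#\<gamma>. i * (if i = k then 1 else 0)) = k * count \<gamma> k" for \<gamma> :: "nat multiset"
      by (induction \<gamma>) (auto simp: algebra_simps)
    then show ?thesis by simp
  qed
  finally show ?thesis .
qed

lemma sum_mset_eq_sum_count: "sum_mset \<beta> = (\<Sum>k\<in>set_mset \<beta>. count \<beta> k * (k::nat))"
proof (induction \<beta>)
  case (add k \<beta>)
  have "(\<Sum>i\<in>set_mset (add_mset k \<beta>). count (add_mset k \<beta>) i * i) =
      (\<Sum>i\<in>insert k (set_mset \<beta>). count \<beta> i * i + (if i = k then k else 0))"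
    by (intro sum.cong) auto
  also have "\<dots> = (\<Sum>i\<in>insert k (set_mset \<beta>). count \<beta> i * i) + k"
    by (simp add: sum.distrib)
  also have "(\<Sum>i\<in>insert k (set_mset \<beta>). count \<beta> i * i) = (\<Sum>i\<in>set_mset \<beta>. count \<beta> i * i)"
    by (rule sum.mono_neutral_right) (auto simp: count_eq_zero_iff)
  finally show ?case using add by simp
qed simp

text \<open>Induction by removing one point \<open>x\<close>. A cycle length \<open>j\<close> of
  \<open>x\<close> contributes \<open>count \<beta> j * j\<close> times the factorial of
  \<open>card S\<close>, and these weights add up to the sum of the parts, which is
  \<open>card S + 1\<close>.\<close>

lemma card_cyc_type:
  assumes "finite S" "0 \<notin># \<beta>" "sum_mset \<beta> = card S"
  shows "card {p. p permutes S \<and> cyc_type S p = \<beta>} * centralizer_order \<beta> = fact (card S)"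
  using assms
proof (induction S arbitrary: \<beta> rule: finite_induct)
  case empty
  then have "\<beta> = {#}" by (cases \<beta>) auto
  moreover have "{p. p permutes {} \<and> cyc_type {} p = {#}} = {id}"
    by (auto simp: cyc_type_def)
  ultimately have "card {p. p permutes {} \<and> cyc_type {} p = \<beta>} = 1"
    by (metis is_singletonI is_singleton_altdef)
  then show ?case using \<open>\<beta> = {#}\<close> by (simp add: centralizer_order_def Aut_def)
next
  case (insert x S)
  \<comment> \<open>The cycle type left when \<open>x\<close> is removed from a cycle of length
    \<open>j\<close>.\<close>
  define red where "red j = (if j = 1 then \<beta> - {#1#} else add_mset (j - 1) (\<beta> - {#j#}))" for j
  \<comment> \<open>The number of ways to put \<open>x\<close> back: as a fixed point, or after any
    point of a cycle of length \<open>j - 1\<close>.\<close>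
  define mult where "mult j = (if j = 1 then 1 else (j - 1) * count (red j) (j - 1))" for j
  define B where "B = set_mset \<beta> - {1}"
  have finB: "finite B" by (simp add: B_def)
  have pos: "j > 0" if "j \<in># \<beta>" for j
    using that insert.prems(1) by (cases j) auto
  have filter: "(\<Sum>p | p permutes T. if Q p then c else 0) = card {p. p permutes T \<and> Q p} * c"
    if "finite T" for T :: "'a set" and Q and c :: nat
    using sum.inter_filter[OF finite_permutations[OF that], of "\<lambda>_. c" Q] by simp
  \<comment> \<open>The left side counts the permutations of type \<open>\<beta>\<close> that become
    \<open>q\<close> when \<open>x\<close> is removed.\<close>
  have fib: "(if cyc_type (insert x S) q = \<beta> then 1 else 0) +
      (\<Sum>b\<in>S. if cyc_type (insert x S) (Transposition.transpose x b \<circ> q) = \<beta> then 1 else 0) =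
      (\<Sum>j\<in>set_mset \<beta>. if cyc_type S q = red j then mult j else 0)" if q: "q permutes S" for q
  proof -
    define \<gamma> where "\<gamma> = cyc_type S q"
    have one: "cyc_type (insert x S) q = \<beta> \<longleftrightarrow> 1 \<in># \<beta> \<and> \<gamma> = red 1"
      using cyc_type_fixpoint[OF insert.hyps q] by (auto simp: red_def \<gamma>_def)
    have char: "cyc_type (insert x S) (Transposition.transpose x b \<circ> q) = \<beta> \<longleftrightarrow>
        (\<exists>j\<in>B. \<gamma> = red j \<and> card (orbit q b) = j - 1)" if b: "b \<in> S" for b
    proof -
      define L where "L = card (orbit q b)"
      have L: "L > 0"
        unfolding L_def by (rule card_orbit_pos[OF permutes_imp_permutation[OF insert.hyps(1) q]])
      have eq: "add_mset L (cyc_type (insert x S) (Transposition.transpose x b \<circ> q)) = add_mset (Suc L) \<gamma>"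
        unfolding L_def \<gamma>_def by (rule cyc_type_insert[OF insert.hyps q b])
      have "cyc_type (insert x S) (Transposition.transpose x b \<circ> q) = \<beta> \<longleftrightarrow> add_mset (Suc L) \<gamma> = add_mset L \<beta>"
        using eq by auto
      also have "\<dots> \<longleftrightarrow> Suc L \<in># \<beta> \<and> \<gamma> = add_mset L (\<beta> - {#Suc L#})"
        by (auto simp: add_eq_conv_ex dest!: multi_member_split)
      also have "\<dots> \<longleftrightarrow> (\<exists>j\<in>B. \<gamma> = red j \<and> L = j - 1)"
      proof
        assume "Suc L \<in># \<beta> \<and> \<gamma> = add_mset L (\<beta> - {#Suc L#})"
        then show "\<exists>j\<in>B. \<gamma> = red j \<and> L = j - 1"
          using L by (intro bexI[of _ "Suc L"]) (auto simp: B_def red_def)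
      next
        assume "\<exists>j\<in>B. \<gamma> = red j \<and> L = j - 1"
        then obtain j where j: "j \<in> B" "\<gamma> = red j" "L = j - 1" by blast
        then have "j = Suc L" using pos[of j] by (auto simp: B_def)
        then show "Suc L \<in># \<beta> \<and> \<gamma> = add_mset L (\<beta> - {#Suc L#})"
          using j by (auto simp: B_def red_def)
      qed
      finally show ?thesis by (simp add: L_def)
    qed
    have "(\<Sum>b\<in>S. if cyc_type (insert x S) (Transposition.transpose x b \<circ> q) = \<beta> then 1 else 0) =
        (\<Sum>b\<in>S. \<Sum>j\<in>B. if \<gamma> = red j \<and> card (orbit q b) = j - 1 then 1 else (0::nat))"
    proof (intro sum.cong refl)
      fix b assume b: "b \<in> S"
      have "(\<Sum>j\<in>B. if \<gamma> = red j \<and> card (orbit q b) = j - 1 then 1 else (0::nat)) =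
          card {j\<in>B. \<gamma> = red j \<and> card (orbit q b) = j - 1}"
        using finB by (simp flip: sum.inter_filter)
      also have "\<dots> = (if \<exists>j\<in>B. \<gamma> = red j \<and> card (orbit q b) = j - 1 then 1 else 0)"
      proof (cases "\<exists>j\<in>B. \<gamma> = red j \<and> card (orbit q b) = j - 1")
        case True
        then obtain j where j: "j \<in> B" "\<gamma> = red j" "card (orbit q b) = j - 1" by blast
        \<comment> \<open>The length of the cycle of \<open>b\<close> determines \<open>j\<close>:
          both candidates are at least 2, so subtracting 1 is injective here.\<close>
        have "j' = j" if "j' \<in> B" "card (orbit q b) = j' - 1" for j'
          using that j pos[of j] pos[of j'] by (auto simp: B_def)
        then have "{j\<in>B. \<gamma> = red j \<and> card (orbit q b) = j - 1} = {j}"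
          using j by auto
        then show ?thesis using True by simp
      next
        case False
        then have "{j\<in>B. \<gamma> = red j \<and> card (orbit q b) = j - 1} = {}" by auto
        then show ?thesis by (simp only: False if_False card.empty)
      qed
      finally show "(if cyc_type (insert x S) (Transposition.transpose x b \<circ> q) = \<beta> then 1 else 0) =
          (\<Sum>j\<in>B. if \<gamma> = red j \<and> card (orbit q b) = j - 1 then 1 else (0::nat))"
        using char[OF b] by simp
    qed
    also have "\<dots> = (\<Sum>j\<in>B. \<Sum>b\<in>S. if \<gamma> = red j \<and> card (orbit q b) = j - 1 then 1 else 0)"
      by (rule sum.swap)
    also have "\<dots> = (\<Sum>j\<in>B. if \<gamma> = red j then mult j else 0)"
    proof (intro sum.cong refl)
      fix j assume "j \<in> B"
      then have "j \<noteq> 1" by (simp add: B_def)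
      moreover have "(\<Sum>b\<in>S. if card (orbit q b) = j - 1 then 1 else 0) = (j - 1) * count \<gamma> (j - 1)"
        unfolding \<gamma>_def card_orbit_size_eq[OF insert.hyps(1) q, symmetric]
        using insert.hyps(1) by (simp flip: sum.inter_filter)
      ultimately show "(\<Sum>b\<in>S. if \<gamma> = red j \<and> card (orbit q b) = j - 1 then 1 else 0) =
          (if \<gamma> = red j then mult j else 0)"
        by (cases "\<gamma> = red j") (simp_all add: mult_def)
    qed
    finally have "(\<Sum>b\<in>S. if cyc_type (insert x S) (Transposition.transpose x b \<circ> q) = \<beta> then 1 else 0) = \<dots>" .
    moreover have "(\<Sum>j\<in>set_mset \<beta>. if \<gamma> = red j then mult j else 0) =
        (if cyc_type (insert x S) q = \<beta> then 1 else 0) + (\<Sum>j\<in>B. if \<gamma> = red j then mult j else 0)"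
    proof (cases "1 \<in># \<beta>")
      case True
      then show ?thesis unfolding B_def one by (subst sum.remove[of _ 1]) (auto simp: mult_def)
    next
      case False
      then have "B = set_mset \<beta>" by (auto simp: B_def)
      then show ?thesis using False one by simp
    qed
    ultimately show ?thesis by (simp add: \<gamma>_def)
  qed
  have "card {p. p permutes insert x S \<and> cyc_type (insert x S) p = \<beta>} =
      (\<Sum>p | p permutes insert x S. if cyc_type (insert x S) p = \<beta> then 1 else 0)"
    using insert.hyps(1) by (subst filter) auto
  also have "\<dots> = (\<Sum>b\<in>insert x S. \<Sum>q | q permutes S.
      if cyc_type (insert x S) (Transposition.transpose x b \<circ> q) = \<beta> then 1 else 0)"
    by (rule sum_over_permutations_insert[OF insert.hyps])
  also have "\<dots> = (\<Sum>q | q permutes S. \<Sum>b\<in>insert x S.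
      if cyc_type (insert x S) (Transposition.transpose x b \<circ> q) = \<beta> then 1 else 0)"
    by (rule sum.swap)
  also have "\<dots> = (\<Sum>q | q permutes S. \<Sum>j\<in>set_mset \<beta>. if cyc_type S q = red j then mult j else 0)"
    using insert.hyps by (intro sum.cong refl) (simp flip: fib)
  also have "\<dots> = (\<Sum>j\<in>set_mset \<beta>. \<Sum>q | q permutes S. if cyc_type S q = red j then mult j else 0)"
    by (rule sum.swap)
  also have "\<dots> = (\<Sum>j\<in>set_mset \<beta>. card {q. q permutes S \<and> cyc_type S q = red j} * mult j)"
    using insert.hyps(1) by (simp only: filter)
  finally have "card {p. p permutes insert x S \<and> cyc_type (insert x S) p = \<beta>} * centralizer_order \<beta> =
      (\<Sum>j\<in>set_mset \<beta>. card {q. q permutes S \<and> cyc_type S q = red j} * (mult j * centralizer_order \<beta>))"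
    by (simp add: sum_distrib_right mult.assoc)
  also have "\<dots> = (\<Sum>j\<in>set_mset \<beta>. fact (card S) * (count \<beta> j * j))"
  proof (intro sum.cong refl)
    fix j assume j: "j \<in># \<beta>"
    define \<delta> where "\<delta> = \<beta> - {#j#}"
    have \<beta>: "\<beta> = add_mset j \<delta>" using j by (simp add: \<delta>_def)
    have red: "red j = (if j = 1 then \<delta> else add_mset (j - 1) \<delta>)"
      by (auto simp: red_def \<delta>_def)
    \<comment> \<open>Both types extend \<open>\<delta>\<close> by one part, and the factors gained
      by the two centralizer orders are exactly \<open>count \<beta> j * j\<close> and
      \<open>mult j\<close>; for \<open>j = 1\<close> the reduced type is \<open>\<delta>\<close>
      itself.\<close>
    have "mult j * centralizer_order \<beta> = centralizer_order (red j) * (count \<beta> j * j)"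
      unfolding \<beta> centralizer_order_add_mset mult_def red
      by (auto simp: centralizer_order_add_mset algebra_simps)
    moreover have "card {q. q permutes S \<and> cyc_type S q = red j} * centralizer_order (red j) = fact (card S)"
    proof (rule insert.IH)
      show "0 \<notin># red j" using insert.prems(1) pos[OF j] by (auto simp: red \<beta>)
      show "sum_mset (red j) = card S"
        using insert.prems(2) insert.hyps pos[OF j] by (auto simp: red \<beta>)
    qed
    ultimately show "card {q. q permutes S \<and> cyc_type S q = red j} * (mult j * centralizer_order \<beta>) =
        fact (card S) * (count \<beta> j * j)"
      by (metis mult.assoc)
  qed
  also have "\<dots> = fact (card S) * sum_mset \<beta>"
    by (simp only: sum_distrib_left[symmetric] sum_mset_eq_sum_count)
  finally show ?case using insert by (simp add: algebra_simps)
qed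

section \<open>The Laurent coefficients\<close>

text \<open>With \<open>e = exp (- u)\<close>, \<open>sinh (i * u / 2)\<close> is
  \<open>exp (u / 2) ^ i * (1 - e ^ i) / 2\<close>, so the powers with exponents
  \<open>count \<beta> i\<close> multiply to the product of \<open>1 - e ^ k\<close> over all parts.
  The exponent lowered by one at \<open>i = 1\<close> divides once by the first factor, which
  produces \<open>hook_poly\<close> and lowers the exponents \<open>d\<close> and
  \<open>size \<beta>\<close> by one.\<close>

lemma sinh_prod_eq:
  fixes u y :: complex
  assumes "is_partition \<beta> d" "d > 0" "y \<noteq> 0" "exp (- u) \<noteq> 1"
  shows "(\<Prod>i=1..d. (sinh (of_nat i / 2 * u) / (of_nat i * y / 2)) powi cexp \<beta> i) =
    exp (u / 2) ^ (d - 1) * poly (hook_poly \<beta>) (exp (- u)) / (of_nat (prod_mset \<beta>) * y ^ (size \<beta> - 1))"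
proof -
  define f where "f = (\<lambda>i. sinh (of_nat i / 2 * u) / (of_nat i * y / 2))"
  define e where "e = exp (- u)"
  have ne: "\<beta> \<noteq> {#}" and sum: "sum_mset \<beta> = d" and zero: "0 \<notin># \<beta>"
    using assms by (auto simp: is_partition_def)
  have f: "f i = exp (u / 2) ^ i * (1 - e ^ i) / (of_nat i * y)" for i
  proof -
    have E1: "exp (of_nat i / 2 * u) = exp (u / 2) ^ i"
      by (simp flip: exp_of_nat_mult)
    have E2: "exp (- (of_nat i / 2 * u)) = exp (u / 2) ^ i * e ^ i"
      unfolding e_def by (simp flip: exp_of_nat_mult exp_add) (simp add: algebra_simps)
    have "a / 2 / (b / 2) = a / b" for a b :: complex by simp
    then show ?thesis
      by (simp only: f_def sinh_field_def E1 E2 right_diff_distrib mult_1_right)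
  qed
  have f1: "f 1 \<noteq> 0"
    unfolding f using assms by (simp add: e_def)
  have "(\<Prod>i=1..d. f i powi cexp \<beta> i) = f 1 powi cexp \<beta> 1 * (\<Prod>i\<in>{1..d} - {1}. f i powi cexp \<beta> i)"
    using \<open>d > 0\<close> by (subst prod.remove[of _ 1]) auto
  \<comment> \<open>The exponent is -1 if no part equals 1; \<open>f 1\<close> is nonzero because
    \<open>exp (- u)\<close> differs from 1.\<close>
  also have "f 1 powi cexp \<beta> 1 = f 1 ^ count \<beta> 1 / f 1"
    using f1 unfolding cexp_def by (simp add: power_int_diff)
  also have "(\<Prod>i\<in>{1..d} - {1}. f i powi cexp \<beta> i) = (\<Prod>i\<in>{1..d} - {1}. f i ^ count \<beta> i)"
    by (intro prod.cong) (auto simp: cexp_def)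
  also have "f 1 ^ count \<beta> 1 / f 1 * (\<Prod>i\<in>{1..d} - {1}. f i ^ count \<beta> i) =
      (\<Prod>i=1..d. f i ^ count \<beta> i) / f 1"
    using \<open>d > 0\<close> by (subst prod.remove[of "{1..d}" 1]) auto
  also have "(\<Prod>i=1..d. f i ^ count \<beta> i) = (\<Prod>i\<in>set_mset \<beta>. f i ^ count \<beta> i)"
  proof (rule prod.mono_neutral_right)
    show "set_mset \<beta> \<subseteq> {1..d}"
    proof
      fix k assume k: "k \<in># \<beta>"
      then have "k \<le> sum_mset \<beta>" by (metis le_add1 mset_add sum_mset.add_mset)
      moreover have "k \<noteq> 0" using k zero by (intro notI) simp
      ultimately show "k \<in> {1..d}" using sum by auto
    qed
  qed (auto simp: not_in_iff)
  also have "\<dots> = (\<Prod>k\<in>#\<beta>. f k)"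
    by (rule image_prod_mset_multiplicity[symmetric])
  also have "\<dots> = exp (u / 2) ^ d * (\<Prod>k\<in>#\<beta>. 1 - e ^ k) / (of_nat (prod_mset \<beta>) * y ^ size \<beta>)"
    unfolding sum[symmetric] by (induction \<beta>) (simp_all add: f power_add ac_simps)
  also have "(\<Prod>k\<in>#\<beta>. 1 - e ^ k) = poly (hook_poly \<beta>) e * (1 - e)"
    by (rule poly_hook_poly[OF ne, symmetric])
  also have "exp (u / 2) ^ d = exp (u / 2) ^ (d - 1) * exp (u / 2)"
    using \<open>d > 0\<close> by (cases d) auto
  also have "y ^ size \<beta> = y ^ (size \<beta> - 1) * y"
    using ne by (cases "size \<beta>") auto
  also have "exp (u / 2) ^ (d - 1) * exp (u / 2) * (poly (hook_poly \<beta>) e * (1 - e)) /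
      (of_nat (prod_mset \<beta>) * (y ^ (size \<beta> - 1) * y)) =
      exp (u / 2) ^ (d - 1) * poly (hook_poly \<beta>) e / (of_nat (prod_mset \<beta>) * y ^ (size \<beta> - 1)) * f 1"
    unfolding f by (simp add: ac_simps)
  also have "\<dots> / f 1 = exp (u / 2) ^ (d - 1) * poly (hook_poly \<beta>) e /
      (of_nat (prod_mset \<beta>) * y ^ (size \<beta> - 1))"
    using f1 by (rule nonzero_mult_div_cancel_right)
  finally show ?thesis by (simp add: f_def e_def)
qed

text \<open>Half of the exponent of \<open>x\<close> comes from \<open>powr\<close> and half from
  \<open>exp (u / 2) ^ (d - 1)\<close>, as \<open>u = Ln x + y\<close>. Together with
  \<open>exp (- u) ^ l\<close> they give the integral power \<open>x ^ (d - 1 - l)\<close>.\<close>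

lemma generating_fn_eq:
  assumes "is_partition \<beta> d" "d > 0" "x \<noteq> 0" "y \<noteq> 0" "exp (- (Ln x + y)) \<noteq> 1"
  shows "generating_fn d m \<beta> x y = (\<Sum>l<d. coeff (hook_poly \<beta>) l / of_nat (prod_mset \<beta>) *
    (x ^ (d - 1 - l) * Ln x ^ m / fact m) * exp (((of_nat d - 1) / 2 - of_nat l) * y)) / y ^ (size \<beta> - 1)"
proof -
  define u where "u = Ln x + y"
  define h where "h = hook_poly \<beta>"
  have ne: "\<beta> \<noteq> {#}" and sum: "sum_mset \<beta> = d" and zero: "0 \<notin># \<beta>"
    using assms by (auto simp: is_partition_def)
  have deg: "degree h < d"
    unfolding h_def using degree_hook_poly[OF ne zero] sum by simp
  have terms: "x powr ((of_nat d - 1) / 2) * (exp (u / 2) ^ (d - 1) * poly h (exp (- u))) =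
      (\<Sum>l<d. coeff h l * (x ^ (d - 1 - l) * exp (((of_nat d - 1) / 2 - of_nat l) * y)))"
  proof -
    have "poly h (exp (- u)) = (\<Sum>l<d. coeff h l * exp (- u) ^ l)"
      unfolding poly_altdef using deg
      by (intro sum.mono_neutral_left) (auto simp: coeff_eq_0)
    moreover have "x powr ((of_nat d - 1) / 2) * (exp (u / 2) ^ (d - 1) * exp (- u) ^ l) =
        x ^ (d - 1 - l) * exp (((of_nat d - 1) / 2 - of_nat l) * y)" if "l < d" for l
    proof -
      have "of_nat (d - 1 - l) = (of_nat d - 1 - of_nat l :: complex)" "of_nat (d - 1) = (of_nat d - 1 :: complex)"
        using that by (simp_all add: of_nat_diff)
      then have "x ^ (d - 1 - l) = exp ((of_nat d - 1 - of_nat l) * Ln x)"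
        and "exp (u / 2) ^ (d - 1) = exp ((of_nat d - 1) * (u / 2))"
        using exp_of_nat_mult[of "d - 1 - l" "Ln x"] exp_of_nat_mult[of "d - 1" "u / 2"] assms(3)
        by simp_all
      moreover have "exp (- u) ^ l = exp (of_nat l * - u)" by (rule exp_of_nat_mult[symmetric])
      moreover have "x powr ((of_nat d - 1) / 2) = exp ((of_nat d - 1) / 2 * Ln x)"
        using assms(3) by (simp add: powr_def)
      ultimately show ?thesis
        by (simp only: exp_add[symmetric]) (rule arg_cong[of _ _ exp], simp add: u_def field_simps)
    qed
    ultimately show ?thesis
      by (simp add: sum_distrib_left mult.left_commute)
  qed
  have "of_nat i / 2 * Ln x + of_nat i / 2 * y = of_nat i / 2 * u" for i
    by (simp add: u_def algebra_simps)
  then have "generating_fn d m \<beta> x y = x powr ((of_nat d - 1) / 2) * Ln x ^ m / of_nat (fact m) *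
      (exp (u / 2) ^ (d - 1) * poly h (exp (- u)) / (of_nat (prod_mset \<beta>) * y ^ (size \<beta> - 1)))"
    unfolding generating_fn_def h_def
    using sinh_prod_eq[OF assms(1,2,4), of u] assms(5) by (simp only: u_def) auto
  also have "\<dots> = x powr ((of_nat d - 1) / 2) * (exp (u / 2) ^ (d - 1) * poly h (exp (- u))) *
      (Ln x ^ m / fact m / of_nat (prod_mset \<beta>)) / y ^ (size \<beta> - 1)"
    by (simp add: ac_simps)
  also have "\<dots> = (\<Sum>l<d. coeff h l / of_nat (prod_mset \<beta>) *
    (x ^ (d - 1 - l) * Ln x ^ m / fact m) * exp (((of_nat d - 1) / 2 - of_nat l) * y)) / y ^ (size \<beta> - 1)"
    unfolding terms sum_distrib_right by (intro arg_cong2[of _ _ _ _ "(/)"] sum.cong refl) (simp add: ac_simps)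
  finally show ?thesis by (simp only: h_def)
qed

section \<open>Cauchy integrals of exponentials\<close>

lemma higher_deriv_exp_linear: "(deriv ^^ k) (\<lambda>y. exp (a * y)) = (\<lambda>y. a ^ k * exp (a * y :: complex))"
proof (induction k)
  case (Suc k)
  have "deriv (\<lambda>y. a ^ k * exp (a * y)) y = a ^ Suc k * exp (a * y)" for y
    by (rule DERIV_imp_deriv) (auto intro!: derivative_eq_intros)
  then show ?case by (simp add: Suc fun_eq_iff)
qed simp

text \<open>Cauchy's formula for the \<open>t\<close>-th derivative at 0.\<close>

lemma has_contour_integral_exp_div_power:
  "((\<lambda>y. exp (a * y) / y ^ Suc t) has_contour_integral 2 * of_real pi * \<i> * a ^ t / fact t) (circlepath 0 1)"
proof -
  have "continuous_on (cball 0 1) (\<lambda>y. exp (a * y))" "(\<lambda>y. exp (a * y)) holomorphic_on ball 0 1"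
    by (auto intro!: continuous_intros holomorphic_intros)
  then show ?thesis
    using Cauchy_has_contour_integral_higher_derivative_circlepath[of 0 1 "\<lambda>y. exp (a * y)" 0 t]
    by (simp add: higher_deriv_exp_linear)
qed

lemma laurent_coeff_generating_fn:
  assumes "is_partition \<beta> d" "d > 0" "x \<noteq> 0" "norm (Ln x) < 1"
    and t: "int t = k + int (size \<beta>) - 1"
  shows "laurent_coeff_y (generating_fn d m \<beta>) k x = (\<Sum>l<d. coeff (hook_poly \<beta>) l / of_nat (prod_mset \<beta>) *
    ((of_nat d - 1) / 2 - of_nat l) ^ t / fact t * (x ^ (d - 1 - l) * Ln x ^ m / fact m))"
proof -
  define c where "c = (\<lambda>l. coeff (hook_poly \<beta>) l / of_nat (prod_mset \<beta>) * (x ^ (d - 1 - l) * Ln x ^ m / fact m))"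
  define a :: "nat \<Rightarrow> complex" where "a = (\<lambda>l. (of_nat d - 1) / 2 - of_nat l)"
  have ne: "size \<beta> > 0" using assms by (auto simp: is_partition_def nonempty_has_size[symmetric])
  have "contour_integral (circlepath 0 1) (\<lambda>y. generating_fn d m \<beta> x y * y powi (- (k + 1))) =
      contour_integral (circlepath 0 1) (\<lambda>y. \<Sum>l<d. c l * (exp (a l * y) / y ^ Suc t))"
  proof (rule contour_integral_eq)
    fix y assume "y \<in> path_image (circlepath 0 1 :: real \<Rightarrow> complex)"
    then have y: "norm y = 1" by simp
    then have y0: "y \<noteq> 0" by auto
    \<comment> \<open>The unit circle avoids the zeros of \<open>sinh (u / 2)\<close> with
      \<open>u = Ln x + y\<close>: the norm of \<open>u\<close> is below 2, too small for a nonzero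
      period of \<open>exp\<close>, and \<open>u = 0\<close> would force the norms of
      \<open>y\<close> and \<open>Ln x\<close> to agree.\<close>
    have "exp (- (Ln x + y)) \<noteq> 1"
    proof
      assume "exp (- (Ln x + y)) = 1"
      then obtain n :: int where n: "Re (- (Ln x + y)) = 0" "Im (- (Ln x + y)) = of_int (2 * n) * pi"
        unfolding exp_eq_1 by auto
      have "norm (Ln x + y) < 2" using norm_triangle_ineq[of "Ln x" y] y assms(4) by linarith
      then have "norm (- (Ln x + y)) < 2" by (simp only: norm_minus_cancel)
      then have "\<bar>of_int (2 * n) * pi\<bar> < 2"
        using abs_Im_le_cmod[of "- (Ln x + y)"] unfolding n(2) by linarith
      then have "\<bar>real_of_int n\<bar> * pi < 1" by (simp add: abs_mult)
      moreover have "\<bar>real_of_int n\<bar> * 1 \<le> \<bar>real_of_int n\<bar> * pi"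
        using pi_gt3 by (intro mult_left_mono) auto
      ultimately have "n = 0" by linarith
      with n have "- (Ln x + y) = 0" by (simp add: complex_eq_iff)
      then have "Ln x + y = 0" by (simp only: neg_equal_0_iff_equal)
      then have "y = - Ln x" by (simp only: add_eq_0_iff)
      then show False using y assms(4) by simp
    qed
    then have "generating_fn d m \<beta> x y = (\<Sum>l<d. c l * exp (a l * y)) / y ^ (size \<beta> - 1)"
      unfolding c_def a_def by (rule generating_fn_eq[OF assms(1-3) y0])
    \<comment> \<open>The pole of order \<open>size \<beta> - 1\<close> shifts the index
      \<open>k\<close> of the coefficient to \<open>t\<close>.\<close>
    moreover have "y powi (- (k + 1)) / y ^ (size \<beta> - 1) = 1 / y ^ Suc t"
    proof -
      have "y powi (- (k + 1)) * y ^ Suc t = y powi (- (k + 1)) * y powi int (Suc t)"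
        by (simp only: power_int_of_nat)
      also have "\<dots> = y powi (- (k + 1) + int (Suc t))"
        by (rule power_int_add[symmetric]) (use y0 in auto)
      also have "- (k + 1) + int (Suc t) = int (size \<beta> - 1)"
        using t ne by simp
      finally have "y powi (- (k + 1)) * y ^ Suc t = y ^ (size \<beta> - 1)"
        by (simp only: power_int_of_nat)
      then show ?thesis using y0 by (simp add: field_simps)
    qed
    ultimately have "generating_fn d m \<beta> x y * y powi (- (k + 1)) =
        (\<Sum>l<d. c l * exp (a l * y)) * (1 / y ^ Suc t)"
      by (simp only: times_divide_eq_left flip: times_divide_eq_right)
    then show "generating_fn d m \<beta> x y * y powi (- (k + 1)) = (\<Sum>l<d. c l * (exp (a l * y) / y ^ Suc t))"
      by (simp only: sum_divide_distrib times_divide_eq_right mult_1_right)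
  qed
  also have "\<dots> = (\<Sum>l<d. c l * (2 * of_real pi * \<i> * a l ^ t / fact t))"
  proof (rule contour_integral_unique, rule has_contour_integral_sum)
    fix l
    show "((\<lambda>y. c l * (exp (a l * y) / y ^ Suc t)) has_contour_integral
        c l * (2 * of_real pi * \<i> * a l ^ t / fact t)) (circlepath 0 1)"
      by (rule has_contour_integral_lmul[OF has_contour_integral_exp_div_power])
  qed simp
  finally show ?thesis
    unfolding laurent_coeff_y_def
    by (simp only: sum_divide_distrib, intro sum.cong refl) (simp add: c_def a_def ac_simps)
qed

section \<open>Derivatives at 1 of powers times logarithms\<close>

text \<open>
  \<open>log_coeff a q m x\<close> is the coefficient of \<open>s ^ m\<close> in \<open>poly q s * x powr (a + s)\<close>; in these terms
  differentiation in \<open>x\<close> multiplies \<open>q\<close> by \<open>s + a\<close> and lowers \<open>a\<close> by one.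
\<close>

definition log_coeff :: "int \<Rightarrow> complex poly \<Rightarrow> nat \<Rightarrow> complex \<Rightarrow> complex" where
  "log_coeff a q m x = x powi a * (\<Sum>i\<le>m. coeff q i * (Ln x ^ (m - i) / fact (m - i)))"

lemma has_field_derivative_Ln_power_fact:
  assumes "Re x > 0"
  shows "((\<lambda>x. Ln x ^ Suc j / fact (Suc j)) has_field_derivative Ln x ^ j / fact j / x) (at x)"
proof -
  have "x \<notin> \<real>\<^sub>\<le>\<^sub>0" using assms by (auto simp: complex_nonpos_Reals_iff)
  then have "(Ln has_field_derivative inverse x) (at x)"
    by (rule has_field_derivative_Ln)
  then have "((\<lambda>x. Ln x ^ Suc j / fact (Suc j)) has_field_derivative
      of_nat (Suc j) * (inverse x * Ln x ^ (Suc j - Suc 0)) / fact (Suc j)) (at x)"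
    by (intro DERIV_cdivide DERIV_power)
  also have "of_nat (Suc j) * (inverse x * Ln x ^ (Suc j - Suc 0)) / fact (Suc j) = Ln x ^ j / fact j / x"
    by (simp add: divide_simps del: of_nat_Suc)
  finally show ?thesis .
qed

text \<open>By the product rule, the power of \<open>x\<close> contributes \<open>a * q\<close>, and
  the logarithms contribute an index shift, which is multiplication of \<open>q\<close> by the
  variable.\<close>

lemma has_field_derivative_log_coeff:
  assumes "Re x > 0"
  shows "(log_coeff a q m has_field_derivative log_coeff (a - 1) ([:of_int a, 1:] * q) m x) (at x)"
proof -
  have x: "x \<noteq> 0" using assms by auto
  define T where "T = (\<lambda>i x. coeff q i * (Ln x ^ (m - i) / fact (m - i)))"
  \<comment> \<open>For \<open>i = m\<close> the logarithm has exponent 0 and the term is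
    constant.\<close>
  define T' where "T' = (\<lambda>i. if i = m then 0 else coeff q i * (Ln x ^ (m - Suc i) / fact (m - Suc i) / x))"
  have T: "(T i has_field_derivative T' i) (at x)" if "i \<le> m" for i
  proof (cases "i = m")
    case True
    then show ?thesis by (simp add: T_def T'_def)
  next
    case False
    then have "m - i = Suc (m - Suc i)" using that by simp
    then show ?thesis unfolding T_def T'_def using False
      by (simp only: if_False) (intro DERIV_cmult has_field_derivative_Ln_power_fact assms)
  qed
  have "((\<lambda>x. x powi a * (\<Sum>i\<le>m. T i x)) has_field_derivative
      (of_int a * x powi (a - 1)) * (\<Sum>i\<le>m. T i x) + (\<Sum>i\<le>m. T' i) * x powi a) (at x)"
    using T x by (intro DERIV_mult DERIV_sum) (auto intro!: derivative_eq_intros)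
  also have "(\<Sum>i\<le>m. T' i) = (\<Sum>i<m. coeff q i * (Ln x ^ (m - Suc i) / fact (m - Suc i))) / x"
  proof -
    have "(\<Sum>i\<le>m. T' i) = (\<Sum>i<m. T' i)"
      by (rule sum.mono_neutral_right) (auto simp: T'_def)
    then show ?thesis by (simp add: T'_def sum_divide_distrib)
  qed
  also have "x powi a = x powi (a - 1) * x"
    using x by (simp add: power_int_diff)
  also have "of_int a * x powi (a - 1) * (\<Sum>i\<le>m. T i x) +
      (\<Sum>i<m. coeff q i * (Ln x ^ (m - Suc i) / fact (m - Suc i))) / x * (x powi (a - 1) * x) =
      x powi (a - 1) * (of_int a * (\<Sum>i\<le>m. T i x) + (\<Sum>i<m. coeff q i * (Ln x ^ (m - Suc i) / fact (m - Suc i))))"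
    using x by (simp add: algebra_simps)
  also have "of_int a * (\<Sum>i\<le>m. T i x) + (\<Sum>i<m. coeff q i * (Ln x ^ (m - Suc i) / fact (m - Suc i))) =
      (\<Sum>i\<le>m. coeff ([:of_int a, 1:] * q) i * (Ln x ^ (m - i) / fact (m - i)))"
  proof -
    have shift: "(\<Sum>i\<le>m. coeff (pCons 0 q) i * (Ln x ^ (m - i) / fact (m - i))) =
        (\<Sum>i<m. coeff q i * (Ln x ^ (m - Suc i) / fact (m - Suc i)))"
      by (subst sum.atMost_shift) simp
    have "coeff ([:of_int a, 1:] * q) i = of_int a * coeff q i + coeff (pCons 0 q) i" for i by simp
    then show ?thesis
      by (simp only: T_def sum_distrib_left sum.distrib distrib_right mult.assoc shift)
  qed
  finally show ?thesis unfolding log_coeff_def[abs_def] T_def .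
qed

text \<open>The exponent falls by one at each differentiation, so the factors \<open>k - c\<close>
  plus the variable, for \<open>c < j\<close>, accumulate to \<open>falling_poly\<close>.\<close>

lemma higher_deriv_sum_log_coeff:
  assumes "finite A" "Re x > 0"
    and "\<And>x. Re x > 0 \<Longrightarrow> F x = (\<Sum>l\<in>A. c l * log_coeff (int (k l)) 1 m x)"
  shows "(deriv ^^ j) F x = (\<Sum>l\<in>A. c l * log_coeff (int (k l) - int j) (falling_poly j (k l)) m x)"
  using assms(2)
proof (induction j arbitrary: x)
  case 0
  then show ?case by (simp add: assms(3) falling_poly_def)
next
  case (Suc j)
  define G where "G = (\<lambda>x. \<Sum>l\<in>A. c l * log_coeff (int (k l) - int j) (falling_poly j (k l)) m x)"
  \<comment> \<open>The induction hypothesis must hold near \<open>x\<close>, not only at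
    \<open>x\<close>, in order to be differentiated.\<close>
  have "eventually (\<lambda>x. x \<in> {x. Re x > 0}) (nhds x)"
    using Suc.prems open_halfspace_Re_gt[of 0] by (intro eventually_nhds_in_open) auto
  then have "eventually (\<lambda>x. (deriv ^^ j) F x = G x) (nhds x)"
    by eventually_elim (simp add: Suc.IH G_def)
  then have "deriv ((deriv ^^ j) F) x = deriv G x"
    by (intro deriv_cong_ev refl)
  also have "deriv G x = (\<Sum>l\<in>A. c l * log_coeff (int (k l) - int j - 1)
      ([:of_int (int (k l) - int j), 1:] * falling_poly j (k l)) m x)"
    unfolding G_def
    by (intro DERIV_imp_deriv DERIV_sum DERIV_cmult has_field_derivative_log_coeff Suc.prems)
  also have "\<dots> = (\<Sum>l\<in>A. c l * log_coeff (int (k l) - int (Suc j)) (falling_poly (Suc j) (k l)) m x)"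
    by (intro sum.cong refl) (simp add: falling_poly_def algebra_simps)
  finally show ?case by simp
qed

text \<open>As \<open>Ln 1 = 0\<close>, only the term without logarithm remains.\<close>

lemma log_coeff_at_1: "log_coeff a q m 1 = coeff q m"
proof -
  have "(\<Sum>i\<le>m. coeff q i * (0 ^ (m - i) / fact (m - i))) = (\<Sum>i\<in>{m}. coeff q i * (0 ^ (m - i) / fact (m - i)))"
    by (rule sum.mono_neutral_right) auto
  then show ?thesis by (simp add: log_coeff_def)
qed

lemma log_coeff_one: "log_coeff (int k) 1 m x = x ^ k * Ln x ^ m / fact m"
proof -
  have "(\<Sum>i\<le>m. coeff 1 i * (Ln x ^ (m - i) / fact (m - i))) = (\<Sum>i\<in>{0}. coeff 1 i * (Ln x ^ (m - i) / fact (m - i)))"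
    by (rule sum.mono_neutral_right) (auto simp: coeff_1)
  then show ?thesis by (simp add: log_coeff_def)
qed

lemma higher_deriv_laurent_coeff:
  assumes "is_partition \<beta> d" "d > 0" "int t = k + int (size \<beta>) - 1"
  shows "(deriv ^^ d) (laurent_coeff_y (generating_fn d m \<beta>) k) 1 =
    (\<Sum>l<d. coeff (hook_poly \<beta>) l / of_nat (prod_mset \<beta>) *
      ((of_nat d - 1) / 2 - of_nat l) ^ t / fact t * coeff (falling_poly d (d - 1 - l)) m)"
proof -
  define c where "c = (\<lambda>l. coeff (hook_poly \<beta>) l / of_nat (prod_mset \<beta>) *
      ((of_nat d - 1) / 2 - of_nat l) ^ t / fact t)"
  \<comment> \<open>This expression is differentiated on the right half-plane; it represents the
    Laurent coefficient where the norm of \<open>Ln x\<close> is below 1, which covers a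
    neighbourhood of 1.\<close>
  define F where "F = (\<lambda>x. \<Sum>l<d. c l * log_coeff (int (d - 1 - l)) 1 m x)"
  have "isCont (\<lambda>x. norm (Ln x)) 1"
    by (intro continuous_intros) auto
  then have "(\<lambda>x. norm (Ln x)) \<midarrow>1\<rightarrow> norm (Ln (1::complex))"
    by (simp only: isCont_def)
  then have "((\<lambda>x. norm (Ln x)) \<longlongrightarrow> norm (Ln (1::complex))) (nhds 1)"
    using tendsto_at_iff_tendsto_nhds[of "\<lambda>x. norm (Ln x)" "1::complex"] by blast
  then have "eventually (\<lambda>x::complex. norm (Ln x) < 1) (nhds 1)"
    by (rule order_tendstoD) simp
  moreover have "eventually (\<lambda>x::complex. x \<noteq> 0) (nhds 1)"
    by (rule t1_space_nhds) simp
  ultimately have "eventually (\<lambda>x. laurent_coeff_y (generating_fn d m \<beta>) k x = F x) (nhds 1)"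
  proof eventually_elim
    case (elim x)
    then show ?case
      unfolding F_def c_def log_coeff_one
      by (intro laurent_coeff_generating_fn[OF assms(1,2) _ _ assms(3)])
  qed
  then have "(deriv ^^ d) (laurent_coeff_y (generating_fn d m \<beta>) k) 1 = (deriv ^^ d) F 1"
    by (intro higher_deriv_cong_ev refl)
  also have "\<dots> = (\<Sum>l<d. c l * coeff (falling_poly d (d - 1 - l)) m)"
    using higher_deriv_sum_log_coeff[of "{..<d}" 1 F c "\<lambda>l. d - 1 - l" m d]
    by (simp add: F_def log_coeff_at_1)
  finally show ?thesis by (simp add: c_def)
qed

section \<open>Hurwitz numbers\<close>

lemma cycle_type_eq_cyc_type: "cycle_type d p = cyc_type {0..<d} p"
  by (simp add: cycle_type_def cyc_type_def cycles_of_def)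

lemma num_cycles_eq_size: "num_cycles d p = size (cyc_type {0..<d} p)"
  by (simp add: num_cycles_def cyc_type_def cycles_of_def)

lemma single_cycles_iff:
  assumes "finite S" "\<sigma> permutes S"
  shows "\<sigma> \<in> single_cycles S \<longleftrightarrow> cyc_type S \<sigma> = {#card S#}"
proof -
  have "size (cyc_type S \<sigma>) = 1 \<longleftrightarrow> cyc_type S \<sigma> = {#card S#}"
  proof
    assume "size (cyc_type S \<sigma>) = 1"
    then obtain a where "cyc_type S \<sigma> = {#a#}" by (blast dest: size_1_singleton_mset)
    then show "cyc_type S \<sigma> = {#card S#}" using sum_mset_cyc_type[OF assms] by simp
  qed simp
  then show ?thesis using assms by (simp add: single_cycles_def)
qed

text \<open>The tuples are grouped by their last entry \<open>p\<close>. The number of choices for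
  the others depends only on the cycle type of \<open>p\<close>, so it is constant over the
  class.\<close>

lemma card_hurwitz_tuples:
  assumes "is_partition \<beta> d" "d > 0"
  shows "of_nat (card (hurwitz_tuples d m t \<beta>)) = of_nat (card {p. p permutes {0..<d} \<and> cyc_type {0..<d} p = \<beta>}) *
    ((\<Sum>l<d. coeff (hook_poly \<beta>) l * (of_nat d * ((of_nat d - 1) / 2 - of_nat l)) ^ t *
      coeff (falling_poly d (d - 1 - l)) m) / of_nat d)"
proof -
  define S where "S = {0..<d}"
  define C where "C = {p. p permutes S \<and> cyc_type S p = \<beta>}"
  define K where "K p = {(\<sigma>, ts). \<sigma> \<in> single_cycles S \<and> (set ts \<subseteq> transpositions S \<and> length ts = t) \<and>
      size (cyc_type S (\<sigma> \<circ> foldr (\<circ>) ts id \<circ> p)) = m}" for p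
  have S: "finite S" "S \<noteq> {}" "card S = d" using assms by (auto simp: S_def)
  have finC: "finite C"
    unfolding C_def using finite_permutations[OF S(1)] by (rule finite_subset[rotated]) auto
  have finK: "finite (K p)" for p
  proof (rule finite_subset)
    show "K p \<subseteq> {\<sigma>. \<sigma> permutes S} \<times> {ts. set ts \<subseteq> transpositions S \<and> length ts = t}"
      by (auto simp: K_def single_cycles_def)
  qed (intro finite_cartesian_product finite_permutations finite_lists_length_eq finite_transpositions S)
  have trans: "is_transposition d \<tau> \<longleftrightarrow> \<tau> \<in> transpositions S" for \<tau>
    by (auto simp: is_transposition_def transpositions_def S_def)
  have "hurwitz_tuples d m t \<beta> = (\<lambda>(p, \<sigma>, ts). (\<sigma>, ts, p)) ` (SIGMA p:C. K p)"
  proof (rule set_eqI, safe)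
    fix \<sigma> ts p assume "(\<sigma>, ts, p) \<in> hurwitz_tuples d m t \<beta>"
    then have "p \<in> C" "(\<sigma>, ts) \<in> K p"
      using single_cycles_iff[OF S(1), of \<sigma>] S(3)
      by (auto simp: hurwitz_tuples_def C_def K_def trans cycle_type_eq_cyc_type num_cycles_eq_size
          simp flip: S_def)
    then show "(\<sigma>, ts, p) \<in> (\<lambda>(p, \<sigma>, ts). (\<sigma>, ts, p)) ` (SIGMA p:C. K p)"
      by (intro image_eqI[of _ _ "(p, \<sigma>, ts)"]) auto
  next
    fix \<sigma> ts p assume "p \<in> C" "(\<sigma>, ts) \<in> K p"
    then show "(\<sigma>, ts, p) \<in> hurwitz_tuples d m t \<beta>"
      using single_cycles_iff[OF S(1), of \<sigma>] S(3)
      by (auto simp: hurwitz_tuples_def C_def K_def trans cycle_type_eq_cyc_type num_cycles_eq_size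
          single_cycles_def simp flip: S_def)
  qed
  then have "card (hurwitz_tuples d m t \<beta>) = card (SIGMA p:C. K p)"
    by (simp only:) (rule card_image, auto simp: inj_on_def)
  also have "\<dots> = (\<Sum>p\<in>C. card (K p))"
    using finC finK by (intro card_SigmaI) auto
  finally have "of_nat (card (hurwitz_tuples d m t \<beta>)) = (\<Sum>p\<in>C. of_nat (card (K p)) :: complex)"
    by simp
  also have "\<dots> = (\<Sum>p\<in>C. (\<Sum>l<d. coeff (hook_poly \<beta>) l *
      (of_nat d * ((of_nat d - 1) / 2 - of_nat l)) ^ t * coeff (falling_poly d (d - 1 - l)) m) / of_nat d)"
  proof (rule sum.cong)
    fix p assume "p \<in> C"
    then show "of_nat (card (K p)) = (\<Sum>l<d. coeff (hook_poly \<beta>) l *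
      (of_nat d * ((of_nat d - 1) / 2 - of_nat l)) ^ t * coeff (falling_poly d (d - 1 - l)) m) / of_nat d"
      using card_factorizations[OF S(1,2), of p t m] by (simp only: C_def K_def S(3) mem_Collect_eq)
  qed simp
  finally show ?thesis by (simp add: C_def S_def)
qed

theorem theorem3p3:
  fixes g m d :: nat and \<beta> :: "nat multiset"
  assumes "m > 0" and "d > 0" and "is_partition \<beta> d"
    and "hurwitz_t g d m \<beta> \<ge> 0"
  shows "quasi_triple_H g d m \<beta> =
    of_nat (fact (nat (hurwitz_t g d m \<beta>))) * of_nat d powi (hurwitz_t g d m \<beta> - 1) *
    (deriv ^^ d) (laurent_coeff_y (generating_fn d m \<beta>) (2 * int g + int m - int d)) 1"
proof -
  define t where "t = nat (hurwitz_t g d m \<beta>)"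
  have t: "hurwitz_t g d m \<beta> = int t" using assms(4) by (simp add: t_def)
  then have tk: "int t = (2 * int g + int m - int d) + int (size \<beta>) - 1"
    by (simp add: hurwitz_t_def)
  define z where "z = card {p. p permutes {0..<d} \<and> cyc_type {0..<d} p = \<beta>}"
  define B where "B = (of_nat (prod_mset \<beta>) :: complex)"
  define \<Sigma> where "\<Sigma> = (\<Sum>l<d. coeff (hook_poly \<beta>) l * ((of_nat d - 1) / 2 - of_nat l) ^ t *
      coeff (falling_poly d (d - 1 - l)) m)"
  \<comment> \<open>The class size cancels \<open>Aut \<beta>\<close> and the factorial and leaves
    the reciprocal of the product of the parts. The same reciprocal comes from the denominators
    under the hyperbolic sines.\<close>
  have "z * centralizer_order \<beta> = fact d"
    using card_cyc_type[of "{0..<d}" \<beta>] assms(3) by (simp add: z_def is_partition_def)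
  then have zB: "of_nat (Aut \<beta>) * of_nat z * B = (of_nat (fact d) :: complex)"
    unfolding B_def centralizer_order_def by (simp only: mult.commute mult.left_commute flip: of_nat_mult)
  moreover have "of_nat (fact d) \<noteq> (0 :: complex)" by simp
  ultimately have "of_nat (Aut \<beta>) * of_nat z \<noteq> (0 :: complex)" by (metis mult_zero_left)
  then have "of_nat (Aut \<beta>) * of_nat z / of_nat (fact d) = 1 / B"
    unfolding zB[symmetric] by (rule nonzero_divide_mult_cancel_left)
  \<comment> \<open>Each of the \<open>t\<close> letters contributes one factor \<open>d\<close>;
    the division by \<open>d\<close> lowers the exponent to \<open>t - 1\<close>.\<close>
  moreover have "of_nat (card (hurwitz_tuples d m t \<beta>)) = of_nat z * (of_nat d ^ t * \<Sigma> / of_nat d)"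
    unfolding card_hurwitz_tuples[OF assms(3,2)] z_def \<Sigma>_def power_mult_distrib
    by (simp add: sum_distrib_left ac_simps)
  ultimately have "quasi_triple_H g d m \<beta> = 1 / B * (of_nat d ^ t * \<Sigma> / of_nat d)"
    unfolding quasi_triple_H_def t_def[symmetric] by (metis times_divide_eq_left mult.assoc mult.commute)
  moreover have "(deriv ^^ d) (laurent_coeff_y (generating_fn d m \<beta>) (2 * int g + int m - int d)) 1 =
      \<Sigma> / B / fact t"
    unfolding higher_deriv_laurent_coeff[OF assms(3,2) tk] \<Sigma>_def B_def sum_divide_distrib
    by (simp add: ac_simps)
  \<comment> \<open>The integer power covers \<open>t = 0\<close>, where the exponent is -1.\<close>
  moreover have "of_nat d powi (int t - 1) = (of_nat d ^ t / of_nat d :: complex)"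
    using assms(2) by (simp add: power_int_diff)
  ultimately show ?thesis
    unfolding t nat_int by simp
qed

end
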